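(* Let $W$ be a Coxeter group of type $A_n$, $B_n$, $D_n$, or $I_2(n)$ (one fixed family, $n$ varying), and let $w$ be sampled uniformly at random from $W$. Then, as $n\to\infty$, $$\Pr[w\text{ is proper}]\longrightarrow 0 .$$
   Context: Let $(W,S)$ be a finite Coxeter system with $S=\{s_1,\dots,s_N\}$, so $N=|S|$ is the rank (thus $N=n$ for types $A_n,B_n,D_n$, and $N=2$ for the dihedral group $I_2(n)$ of order $2n$). Let $\ell$ be the Coxeter length. For $I\subseteq[N]=\{1,\dots,N\}$ let $W_I$ be the parabolic subgroup generated by $\{s_i\mid i\in I\}$, and let $w_0(W_I)$ be its unique element of maximal length. The left descent set of $w\in W$ is $J(w)=\{j\in[N]\mid \ell(s_jw)<\ell(w)\}$ and $d(w)=|J(w)|$. For an integer $0\le x\le N$ put $\mathsf{maxw}_0(W,x)=\max\{\ell(w_0(W_I))\mid I\subseteq[N],\ |I|=x\}$. An element $w\in W$ is proper if $\ell(w)\le N+\mathsf{maxw}_0(W,d(w))$. *)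

theory Defs
  imports "HOL-Algebra.Generated_Groups" "HOL-Probability.Probability"
begin

text \<open>The entry \<open>0\<close> of a Coxeter matrix encodes the label infinity, i.e. the absence of a relation.\<close>

definition is_coxeter_matrix :: "nat \<Rightarrow> (nat \<Rightarrow> nat \<Rightarrow> nat) \<Rightarrow> bool" where
  "is_coxeter_matrix N m \<longleftrightarrow>
     (\<forall>i\<in>{1..N}. m i i = 1) \<and>
     (\<forall>i\<in>{1..N}. \<forall>j\<in>{1..N}. m i j = m j i \<and> (i \<noteq> j \<longrightarrow> m i j \<noteq> 1))"

text \<open>Insertion of one relator \<open>(s\<^sub>i s\<^sub>j)\<^bsup>m(i,j)\<^esup>\<close> into a word. For \<open>i = j\<close> the relator is
  \<open>s\<^sub>i s\<^sub>i\<close>, so every generator is its own inverse and words in the generators themselves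
  suffice to express the group presentation.\<close>

inductive coxeter_step :: "nat \<Rightarrow> (nat \<Rightarrow> nat \<Rightarrow> nat) \<Rightarrow> nat list \<Rightarrow> nat list \<Rightarrow> bool"
  for N m where
  "i \<in> {1..N} \<Longrightarrow> j \<in> {1..N} \<Longrightarrow>
     coxeter_step N m (u @ v) (u @ concat (replicate (m i j) [i, j]) @ v)"

definition word_prod :: "('a, 'b) monoid_scheme \<Rightarrow> (nat \<Rightarrow> 'a) \<Rightarrow> nat list \<Rightarrow> 'a" where
  "word_prod W s xs = foldr (\<lambda>i w. s i \<otimes>\<^bsub>W\<^esub> w) xs \<one>\<^bsub>W\<^esub>"

text \<open>\<open>W\<close> is the group presented by \<open>s\<^sub>1, \<dots>, s\<^sub>N\<close> subject to \<open>(s\<^sub>i s\<^sub>j)\<^bsup>m(i,j)\<^esup> = 1\<close>.\<close>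

locale coxeter_system = group W for W (structure) +
  fixes N :: nat and s :: "nat \<Rightarrow> 'a" and m :: "nat \<Rightarrow> nat \<Rightarrow> nat"
  assumes coxeter_matrix: "is_coxeter_matrix N m"
    and gens_closed: "s ` {1..N} \<subseteq> carrier W"
    and gens_inj: "inj_on s {1..N}"
    and gens_generate: "generate W (s ` {1..N}) = carrier W"
    and presentation: "\<And>u v. u \<in> lists {1..N} \<Longrightarrow> v \<in> lists {1..N} \<Longrightarrow>
      word_prod W s u = word_prod W s v \<longleftrightarrow> equivclp (coxeter_step N m) u v"
begin

definition cox_length :: "'a \<Rightarrow> nat" where
  "cox_length w = (LEAST k. \<exists>xs \<in> lists {1..N}. length xs = k \<and> word_prod W s xs = w)"

definition parabolic :: "nat set \<Rightarrow> 'a set" where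
  "parabolic I = generate W (s ` I)"

definition longest :: "nat set \<Rightarrow> 'a" where
  "longest I = (ARG_MAX cox_length w. w \<in> parabolic I)"

definition left_descents :: "'a \<Rightarrow> nat set" where
  "left_descents w = {j \<in> {1..N}. cox_length (s j \<otimes> w) < cox_length w}"

definition maxw0 :: "nat \<Rightarrow> nat" where
  "maxw0 x = Max {cox_length (longest I) |I. I \<subseteq> {1..N} \<and> card I = x}"

definition proper :: "'a \<Rightarrow> bool" where
  "proper w \<longleftrightarrow> cox_length w \<le> N + maxw0 (card (left_descents w))"

end

datatype coxeter_family = Type_A | Type_B | Type_D | Type_I2

fun family_rank :: "coxeter_family \<Rightarrow> nat \<Rightarrow> nat" where
  "family_rank Type_I2 n = 2"
| "family_rank _ n = n"

fun min_index :: "coxeter_family \<Rightarrow> nat" where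
  "min_index Type_A = 1"
| "min_index Type_B = 2"
| "min_index Type_D = 4"
| "min_index Type_I2 = 3"

text \<open>Labels of the Coxeter diagrams, for nodes \<open>i < j\<close> (label \<open>2\<close> means no edge). Type \<open>B\<^sub>n\<close> is
  the path \<open>1, \<dots>, n\<close> with last edge labelled \<open>4\<close>; type \<open>D\<^sub>n\<close> is the path \<open>1, \<dots>, n - 1\<close> with
  the node \<open>n\<close> attached to \<open>n - 2\<close>.\<close>

fun diagram_label :: "coxeter_family \<Rightarrow> nat \<Rightarrow> nat \<Rightarrow> nat \<Rightarrow> nat" where
  "diagram_label Type_A n i j = (if j = i + 1 then 3 else 2)"
| "diagram_label Type_B n i j = (if j = i + 1 then (if j = n then 4 else 3) else 2)"
| "diagram_label Type_D n i j =
     (if (j = i + 1 \<and> j < n) \<or> (j = n \<and> i + 2 = n) then 3 else 2)"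
| "diagram_label Type_I2 n i j = n"

definition family_matrix :: "coxeter_family \<Rightarrow> nat \<Rightarrow> nat \<Rightarrow> nat \<Rightarrow> nat" where
  "family_matrix F n i j = (if i = j then 1 else diagram_label F n (min i j) (max i j))"

end

theory Submission
  imports Defs
begin

text \<open>
  By symmetry \<open>d(w)\<close> has mean \<open>N/2\<close>, while the length, being the number of reflections \<open>t\<close> with
  \<open>\<ell>(t w) < \<ell>(w)\<close>, has mean half the number of reflections: about \<open>n\<^sup>2/4\<close> in type \<open>A\<close> and \<open>n\<^sup>2/2\<close> in
  types \<open>B\<close> and \<open>D\<close>. A parabolic subgroup of rank \<open>x \<approx> n/2\<close> has longest element of length at most
  about \<open>n\<^sup>2/8\<close>, respectively \<open>n\<^sup>2/4\<close>, so a proper element is atypical for one of the two statistics.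
  Both are sums of signs indexed by reflections, and the signs of two commuting reflections are
  uncorrelated; as most pairs of reflections commute, Chebyshev's inequality bounds the proportion
  of proper elements by a multiple of \<open>1/n\<close>. In the dihedral group the mean of \<open>d\<close> is \<open>1\<close> and only
  the identity has no descent, so only one element has two descents, and every other proper element
  has length at most \<open>3\<close>.
\<close>

section \<open>Coxeter systems and the reflection cocycle\<close>

text \<open>The group is given only by its presentation: neither its finiteness nor the equality of
  length and inversion number is among the hypotheses. Two one-sided estimates do the work. A
  representation by signed permutations, with inversions counted on pairs of points, bounds the
  length from below; coset chains in parabolic subgroups bound it from above, which also yields
  finiteness. That left multiplication by \<open>s j\<close> toggles the descent \<open>j\<close>
  and keeps every descent at a commuting generator is derived from the reflection cocycle. Types A,
  B and D differ only at the end of the diagram, so they share one locale. The deviations allowed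
  are fixed by the tightest case, type A: \<open>d < 11/20 N\<close> makes twice the length of a
  proper element at most about \<open>0.3025 N^2\<close>, while twice the inversion number of a
  typical element exceeds about \<open>0.4 N^2\<close>.\<close>

context coxeter_system
begin

section \<open>Words in the generators and the length function\<close>

abbreviation gens :: "nat set" where "gens \<equiv> {1..N}"

abbreviation wp :: "nat list \<Rightarrow> 'a" where "wp \<equiv> word_prod W s"

lemma gen_in_carrier [simp]: "i \<in> gens \<Longrightarrow> s i \<in> carrier W"
  using gens_closed by auto

lemma wp_Nil [simp]: "wp [] = \<one>"
  by (simp add: word_prod_def)

lemma wp_Cons [simp]: "wp (i # u) = s i \<otimes> wp u"
  by (simp add: word_prod_def)

lemma wp_closed [simp]: "set u \<subseteq> gens \<Longrightarrow> wp u \<in> carrier W"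
  by (induction u) auto

lemma wp_append: "set u \<subseteq> gens \<Longrightarrow> set v \<subseteq> gens \<Longrightarrow> wp (u @ v) = wp u \<otimes> wp v"
  by (induction u) (auto simp: m_assoc)

lemma matrix_sym: "i \<in> gens \<Longrightarrow> j \<in> gens \<Longrightarrow> m i j = m j i"
  using coxeter_matrix by (auto simp: is_coxeter_matrix_def)

lemma matrix_diag: "i \<in> gens \<Longrightarrow> m i i = 1"
  using coxeter_matrix by (auto simp: is_coxeter_matrix_def)

lemma relator_in_gens: "i \<in> gens \<Longrightarrow> j \<in> gens \<Longrightarrow> set (concat (replicate k [i, j])) \<subseteq> gens"
  by (induction k) auto

lemma wp_relator:
  assumes "i \<in> gens" "j \<in> gens"
  shows "wp (concat (replicate (m i j) [i, j])) = \<one>"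
proof -
  have "coxeter_step N m ([] @ []) ([] @ concat (replicate (m i j) [i, j]) @ [])"
    using assms by (rule coxeter_step.intros)
  then have "equivclp (coxeter_step N m) [] (concat (replicate (m i j) [i, j]))"
    by (auto intro: r_into_equivclp)
  then show ?thesis
    using presentation[of "[]" "concat (replicate (m i j) [i, j])"] relator_in_gens[OF assms]
    by (metis in_listsI lists.Nil subsetD wp_Nil)
qed

lemma gen_square [simp]: "i \<in> gens \<Longrightarrow> s i \<otimes> s i = \<one>"
  using wp_relator[of i i] by (simp add: matrix_diag)

lemma gen_cancel_left [simp]: "i \<in> gens \<Longrightarrow> x \<in> carrier W \<Longrightarrow> s i \<otimes> (s i \<otimes> x) = x"
  by (simp flip: m_assoc)

lemma gen_cancel_right [simp]: "i \<in> gens \<Longrightarrow> x \<in> carrier W \<Longrightarrow> x \<otimes> s i \<otimes> s i = x"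
  by (simp add: m_assoc)

lemma inv_gen [simp]: "i \<in> gens \<Longrightarrow> inv (s i) = s i"
  by (simp add: inv_equality)

lemma word_in_parabolic:
  assumes "I \<subseteq> gens" "w \<in> parabolic I"
  obtains u where "set u \<subseteq> I" "wp u = w"
proof -
  have "\<exists>u. set u \<subseteq> I \<and> wp u = w"
    using assms(2) unfolding parabolic_def
  proof (induction rule: generate.induct)
    case one
    show ?case by (intro exI[of _ "[]"]) simp
  next
    case (incl h)
    then obtain i where "i \<in> I" "h = s i" by auto
    then show ?case using assms(1) by (intro exI[of _ "[i]"]) (auto simp: subset_iff)
  next
    case (inv h)
    then obtain i where "i \<in> I" "h = s i" by auto
    then show ?case using assms(1) by (intro exI[of _ "[i]"]) (auto simp: subset_iff)
  next
    case (eng h1 h2)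
    then obtain u v where "set u \<subseteq> I" "wp u = h1" "set v \<subseteq> I" "wp v = h2" by auto
    then show ?case using assms(1) by (intro exI[of _ "u @ v"]) (auto simp: wp_append)
  qed
  then show ?thesis using that by auto
qed

lemma parabolic_gens: "parabolic gens = carrier W"
  using gens_generate by (simp add: parabolic_def)

lemma word_of:
  assumes "w \<in> carrier W"
  obtains u where "set u \<subseteq> gens" "wp u = w"
  using word_in_parabolic[of gens w] assms parabolic_gens by auto

lemma cox_length_le:
  assumes "set u \<subseteq> gens"
  shows "cox_length (wp u) \<le> length u"
  unfolding cox_length_def using assms by (intro Least_le) auto

lemma reduced_word:
  assumes "w \<in> carrier W"
  obtains u where "set u \<subseteq> gens" "wp u = w" "length u = cox_length w"
proof -
  obtain v where "set v \<subseteq> gens" "wp v = w" using word_of[OF assms] .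
  then have "\<exists>k. \<exists>xs\<in>lists gens. length xs = k \<and> wp xs = w" by auto
  from LeastI_ex[OF this] show ?thesis using that unfolding cox_length_def by auto
qed

lemma cox_length_mult:
  assumes "x \<in> carrier W" "y \<in> carrier W"
  shows "cox_length (x \<otimes> y) \<le> cox_length x + cox_length y"
proof -
  obtain u v where u: "set u \<subseteq> gens" "wp u = x" "length u = cox_length x"
    and v: "set v \<subseteq> gens" "wp v = y" "length v = cox_length y"
    using assms by (metis reduced_word)
  show ?thesis using cox_length_le[of "u @ v"] u v by (auto simp: wp_append)
qed

lemma finite_bounded_length: "finite {w \<in> carrier W. cox_length w \<le> L}"
proof (rule finite_subset)
  show "{w \<in> carrier W. cox_length w \<le> L} \<subseteq> wp ` {u. set u \<subseteq> gens \<and> length u \<le> L}"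
  proof
    fix w assume w: "w \<in> {w \<in> carrier W. cox_length w \<le> L}"
    then obtain u where "set u \<subseteq> gens" "wp u = w" "length u = cox_length w"
      using reduced_word[of w] by auto
    with w show "w \<in> wp ` {u. set u \<subseteq> gens \<and> length u \<le> L}" by auto
  qed
  show "finite (wp ` {u. set u \<subseteq> gens \<and> length u \<le> L})"
    using finite_lists_length_le[of gens] by auto
qed

text \<open>A function of words that ignores inserted relators factors through the group. It serves
  the reflection cocycle, the action on points and the dihedral action on residues.\<close>

lemma word_invariant:
  assumes inv: "\<And>u v i j. \<lbrakk>set u \<subseteq> gens; set v \<subseteq> gens; i \<in> gens; j \<in> gens\<rbrakk>
      \<Longrightarrow> f (u @ concat (replicate (m i j) [i, j]) @ v) = f (u @ v)"
    and "wp u = wp v" "set u \<subseteq> gens" "set v \<subseteq> gens"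
  shows "f u = f v"
proof -
  \<comment> \<open>The chain of steps from \<open>u\<close> to \<open>v\<close> passes through
    words not known to lie over \<open>gens\<close>, so that property is carried along, in both
    directions.\<close>
  have step: "f x = f y \<and> (set x \<subseteq> gens \<longleftrightarrow> set y \<subseteq> gens)"
    if "coxeter_step N m x y" "set x \<subseteq> gens \<or> set y \<subseteq> gens" for x y
    using that
  proof cases
    case (1 i j u v)
    then show ?thesis using inv[of u v i j] relator_in_gens[of i j "m i j"] that(2) by auto
  qed
  have "equivclp (coxeter_step N m) u v"
    using assms presentation[of u v] by (auto simp: lists_eq_set)
  then have "f u = f v \<and> set v \<subseteq> gens"
    unfolding equivclp_def
  proof (induction rule: rtranclp_induct)
    case base
    then show ?case using assms by simp
  next
    case (step y z)
    then show ?case using \<open>\<And>x y. _ \<Longrightarrow> _ \<Longrightarrow> f x = f y \<and> _\<close>[of y z]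
        \<open>\<And>x y. _ \<Longrightarrow> _ \<Longrightarrow> f x = f y \<and> _\<close>[of z y]
      by (auto simp: symclp_def)
  qed
  then show ?thesis by simp
qed

text \<open>\<open>flips u t\<close> is the parity of the number of prefixes \<open>v i\<close> of \<open>u\<close> with
  \<open>t = v s\<^sub>i v\<^sup>-\<^sup>1\<close>. It only depends on the product of \<open>u\<close> (Bourbaki's reflection cocycle),
  and this yields the exchange property.\<close>

fun flips :: "nat list \<Rightarrow> 'a \<Rightarrow> bool" where
  "flips [] t = False"
| "flips (i # u) t = ((t = s i) \<noteq> flips u (s i \<otimes> t \<otimes> s i))"

lemma flips_append:
  "set u \<subseteq> gens \<Longrightarrow> t \<in> carrier W \<Longrightarrow>
   flips (u @ v) t = (flips u t \<noteq> flips v (inv (wp u) \<otimes> t \<otimes> wp u))"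
  by (induction u arbitrary: t) (auto simp: inv_mult_group m_assoc)

text \<open>The prefixes of an alternating word give the reflections \<open>r^k s_i\<close> with
  \<open>r = s_i s_j\<close> and \<open>k < 2a\<close>. Removing the first two letters conjugates
  \<open>t\<close> and lowers the exponent by 2, whence the induction.\<close>

lemma flips_alternating:
  assumes "i \<in> gens" "j \<in> gens" "t \<in> carrier W"
  shows "flips (concat (replicate a [i, j])) t =
    odd (card {k. k < 2 * a \<and> t = (s i \<otimes> s j) [^] k \<otimes> s i})"
  using assms(3)
proof (induction a arbitrary: t)
  case (Suc a)
  let ?r = "s i \<otimes> s j"
  let ?t = "s j \<otimes> (s i \<otimes> t \<otimes> s i) \<otimes> s j"
  have r: "?r \<in> carrier W" using assms by simp
  have [simp]: "s i \<in> carrier W" "s j \<in> carrier W" "t \<in> carrier W" using assms Suc.prems by auto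
  have conj: "(?t = ?r [^] k \<otimes> s i) \<longleftrightarrow> (t = ?r [^] (k + 2) \<otimes> s i)" for k :: nat
  proof -
    have "t = ?r \<otimes> ?t \<otimes> (s j \<otimes> s i)" using assms by (simp add: m_assoc)
    moreover have "?t = (s j \<otimes> s i) \<otimes> t \<otimes> ?r" by (simp add: m_assoc)
    moreover have "?r [^] (k + 2) = ?r \<otimes> ?r [^] k \<otimes> ?r"
      using nat_pow_Suc2[OF r, of "Suc k"] r by (simp add: m_assoc)
    then have "?r [^] (k + 2) \<otimes> s i = ?r \<otimes> (?r [^] k \<otimes> s i) \<otimes> (s j \<otimes> s i)"
      and "(s j \<otimes> s i) \<otimes> (?r [^] (k + 2) \<otimes> s i) \<otimes> ?r = ?r [^] k \<otimes> s i"
      using assms r by (simp_all add: m_assoc del: nat_pow_Suc)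
    ultimately show ?thesis by metis
  qed
  have one: "(s i \<otimes> t \<otimes> s i = s j) \<longleftrightarrow> (t = ?r [^] (1::nat) \<otimes> s i)"
  proof -
    have "s i \<otimes> (s i \<otimes> t \<otimes> s i) \<otimes> s i = t" "s i \<otimes> (s i \<otimes> s j \<otimes> s i) \<otimes> s i = s j"
      using assms by (simp_all add: m_assoc)
    moreover have "?r [^] (1::nat) = ?r" using r by simp
    ultimately show ?thesis by metis
  qed
  have split: "{k. k < 2 * Suc a \<and> t = ?r [^] k \<otimes> s i} =
      {k. k = 0 \<and> t = s i} \<union> {k. k = 1 \<and> t = ?r [^] (1::nat) \<otimes> s i}
      \<union> (\<lambda>k. k + 2) ` {k. k < 2 * a \<and> t = ?r [^] (k + 2) \<otimes> s i}" (is "?A = ?B \<union> ?C \<union> ?D")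
  proof (intro Set.set_eqI iffI)
    fix k assume "k \<in> ?A"
    moreover have "k = 0 \<or> k = 1 \<or> (\<exists>l. k = l + 2)" by presburger
    ultimately show "k \<in> ?B \<union> ?C \<union> ?D" by auto
  qed auto
  have "card ?A = card ?B + card ?C + card ?D"
    unfolding split by (subst card_Un_disjoint, auto)+
  also have "card ?D = card {k. k < 2 * a \<and> t = ?r [^] (k + 2) \<otimes> s i}"
    by (intro card_image) (auto simp: inj_on_def)
  also have "card ?B = (if t = s i then 1 else 0)" by auto
  also have "card ?C = (if t = ?r [^] (1::nat) \<otimes> s i then 1 else 0)" by auto
  finally have A: "card ?A = (if t = s i then 1 else 0) + (if t = ?r [^] (1::nat) \<otimes> s i then 1 else 0)
     + card {k. k < 2 * a \<and> t = ?r [^] (k + 2) \<otimes> s i}" .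
  have IH: "flips (concat (replicate a [i, j])) ?t =
      odd (card {k. k < 2 * a \<and> t = ?r [^] (k + 2) \<otimes> s i})"
    using Suc.IH[of ?t] conj by simp
  show ?case
    unfolding A using IH one by auto
qed simp

text \<open>Since \<open>r^m = 1\<close>, the \<open>2m\<close> reflections read off the relator
  form one list of length \<open>m\<close> repeated, so each occurs an even number of times.\<close>

lemma flips_relator:
  assumes "i \<in> gens" "j \<in> gens" "t \<in> carrier W"
  shows "\<not> flips (concat (replicate (m i j) [i, j])) t"
proof -
  let ?r = "s i \<otimes> s j" and ?m = "m i j"
  have r: "?r \<in> carrier W" using assms by simp
  have "wp (concat (replicate a [i, j])) = ?r [^] a" for a
  proof (induction a)
    case (Suc a)
    then show ?case using nat_pow_Suc2[OF r, of a] assms by (simp add: m_assoc)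
  qed simp
  then have rm: "?r [^] ?m = \<one>" using wp_relator[OF assms(1,2)] by simp
  let ?P = "\<lambda>k. t = ?r [^] k \<otimes> s i"
  have per: "?P (k + ?m) = ?P k" for k
    using r rm by (simp flip: nat_pow_mult)
  have split: "{k. k < 2 * ?m \<and> ?P k} = {k. k < ?m \<and> ?P k} \<union> (\<lambda>k. k + ?m) ` {k. k < ?m \<and> ?P k}"
    (is "?A = ?B \<union> ?C")
  proof (intro Set.set_eqI iffI)
    fix k assume k: "k \<in> ?A"
    show "k \<in> ?B \<union> ?C"
    proof (cases "k < ?m")
      case False
      then have "k = (k - ?m) + ?m" by simp
      moreover from this have "?P (k - ?m)" using per[of "k - ?m"] k by simp
      moreover have "k - ?m < ?m" using False k by auto
      ultimately show ?thesis by (metis (mono_tags, lifting) UnI2 image_eqI mem_Collect_eq)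
    qed (use k in auto)
  qed (use per in auto)
  have "card ?A = card ?B + card ?C"
    unfolding split by (rule card_Un_disjoint) auto
  also have "card ?C = card ?B" by (intro card_image) auto
  finally show ?thesis using flips_alternating[OF assms, of ?m] by simp
qed

lemma flips_well_defined:
  assumes "wp u = wp v" "set u \<subseteq> gens" "set v \<subseteq> gens" "t \<in> carrier W"
  shows "flips u t = flips v t"
  using _ assms(1-3)
proof (rule word_invariant[where f = "\<lambda>u. flips u t"])
  fix u v i j assume *: "set u \<subseteq> gens" "set v \<subseteq> gens" "i \<in> gens" "j \<in> gens"
  have "inv (wp u) \<otimes> t \<otimes> wp u \<in> carrier W" using * assms(4) by auto
  then show "flips (u @ concat (replicate (m i j) [i, j]) @ v) t = flips (u @ v) t"
    using * assms(4)
    by (simp add: flips_append relator_in_gens wp_relator flips_relator)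
qed

text \<open>Some prefix \<open>v i\<close> of \<open>u\<close> satisfies
  \<open>t = v s_i v^-1\<close>, and multiplying by \<open>t\<close> deletes that letter
  \<open>i\<close>.\<close>

lemma flips_deletion:
  assumes "flips u t" "set u \<subseteq> gens" "t \<in> carrier W"
  shows "\<exists>v. set v \<subseteq> gens \<and> length v < length u \<and> wp v = t \<otimes> wp u"
  using assms
proof (induction u arbitrary: t)
  case (Cons i u)
  show ?case
  proof (cases "t = s i")
    case True
    then show ?thesis using Cons.prems by (intro exI[of _ u]) auto
  next
    case False
    then obtain v where v: "set v \<subseteq> gens" "length v < length u" "wp v = s i \<otimes> t \<otimes> s i \<otimes> wp u"
      using Cons.IH[of "s i \<otimes> t \<otimes> s i"] Cons.prems by auto
    then show ?thesis using Cons.prems by (intro exI[of _ "i # v"]) (auto simp: m_assoc)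
  qed
qed simp

text \<open>A flip at \<open>s j\<close> shortens a reduced word by deletion. Prefixing
  \<open>j\<close> toggles the flip at \<open>s j\<close>, so without a flip it is
  \<open>s j \<otimes> wp u\<close> that has one, and hence is the longer element.\<close>

lemma descent_iff_flips:
  assumes "set u \<subseteq> gens" "j \<in> gens"
  shows "j \<in> left_descents (wp u) \<longleftrightarrow> flips u (s j)"
proof -
  have less: "cox_length (s j \<otimes> wp x) < cox_length (wp x)" if "flips x (s j)" "set x \<subseteq> gens" for x
  proof -
    obtain y where y: "set y \<subseteq> gens" "wp y = wp x" "length y = cox_length (wp x)"
      using reduced_word[of "wp x"] \<open>set x \<subseteq> gens\<close> by auto
    then have "flips y (s j)" using flips_well_defined[of x y "s j"] that assms by auto
    then obtain v where "set v \<subseteq> gens" "length v < length y" "wp v = s j \<otimes> wp y"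
      using flips_deletion[of y "s j"] assms y by auto
    then show ?thesis using cox_length_le[of v] y by auto
  qed
  have "flips (j # u) (s j) \<longleftrightarrow> \<not> flips u (s j)" using assms by simp
  then have "\<not> flips u (s j) \<Longrightarrow> cox_length (wp u) < cox_length (s j \<otimes> wp u)"
    using less[of "j # u"] assms by simp
  then show ?thesis using less[of u] assms by (fastforce simp: left_descents_def)
qed

section \<open>Descents under left multiplication\<close>

lemma descent_self:
  assumes "w \<in> carrier W" "j \<in> gens"
  shows "j \<in> left_descents (s j \<otimes> w) \<longleftrightarrow> j \<notin> left_descents w"
proof -
  obtain u where "set u \<subseteq> gens" "wp u = w" using word_of[OF assms(1)] .
  then show ?thesis
    using descent_iff_flips[of u j] descent_iff_flips[of "j # u" j] assms by auto
qed

lemma gens_commute: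
  assumes "i \<in> gens" "j \<in> gens" "m i j = 2"
  shows "s i \<otimes> s j = s j \<otimes> s i"
proof -
  have "s i \<otimes> (s j \<otimes> (s i \<otimes> s j)) = \<one>"
    using wp_relator[of i j] assms by (simp add: numeral_2_eq_2)
  then have "s j \<otimes> (s i \<otimes> (s i \<otimes> (s j \<otimes> (s i \<otimes> s j)))) = s j \<otimes> (s i \<otimes> \<one>)" by simp
  then show ?thesis using assms by simp
qed

text \<open>Conjugation by \<open>s j\<close> fixes \<open>s k\<close>, so a leading letter
  \<open>j\<close> does not alter the cocycle at \<open>s k\<close>; that the two generators differ
  as group elements comes from \<open>gens_inj\<close>.\<close>

lemma descent_commuting:
  assumes "w \<in> carrier W" "j \<in> gens" "k \<in> gens" "j \<noteq> k" "m j k = 2"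
  shows "k \<in> left_descents (s j \<otimes> w) \<longleftrightarrow> k \<in> left_descents w"
proof -
  obtain u where u: "set u \<subseteq> gens" "wp u = w" using word_of[OF assms(1)] .
  have "s j \<otimes> s k \<otimes> s j = s k"
    using gens_commute[of j k] assms by (simp add: m_assoc)
  moreover have "s k \<noteq> s j" using assms inj_onD[OF gens_inj, of k j] by blast
  ultimately show ?thesis
    using descent_iff_flips[of u k] descent_iff_flips[of "j # u" k] assms u by simp
qed

lemma descent_exists:
  assumes "w \<in> carrier W" "w \<noteq> \<one>"
  shows "left_descents w \<noteq> {}"
proof -
  obtain u where u: "set u \<subseteq> gens" "wp u = w" "length u = cox_length w"
    using reduced_word[OF assms(1)] .
  with assms obtain i v where "u = i # v" by (cases u) auto
  with u have "i \<in> left_descents w"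
    using cox_length_le[of v] by (auto simp: left_descents_def)
  then show ?thesis by auto
qed

lemma card_descents_le: "card (left_descents w) \<le> N"
proof -
  have "card (left_descents w) \<le> card gens"
    by (intro card_mono) (auto simp: left_descents_def)
  then show ?thesis by simp
qed

lemma bij_left_mult: "x \<in> carrier W \<Longrightarrow> bij_betw (\<lambda>w. x \<otimes> w) (carrier W) (carrier W)"
  by (rule bij_betwI[where g = "\<lambda>w. inv x \<otimes> w"]) (auto simp flip: m_assoc)

lemma bij_right_mult: "x \<in> carrier W \<Longrightarrow> bij_betw (\<lambda>w. w \<otimes> x) (carrier W) (carrier W)"
  by (rule bij_betwI[where g = "\<lambda>w. w \<otimes> inv x"]) (auto simp: m_assoc)

end

section \<open>Concentration of descents and inversions\<close>

text \<open>After expanding the square, the correlation of \<open>p\<close> and \<open>q\<close>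
  vanishes whenever a bijection of \<open>A\<close> negates the product of their signs. Only pairs
  in \<open>Q\<close> survive, each contributing at most \<open>card A\<close>.\<close>

lemma second_moment_bound:
  fixes e :: "'i \<Rightarrow> 'w \<Rightarrow> real"
  assumes "finite A" "finite P" "finite Q"
    and bound: "\<And>p w. p \<in> P \<Longrightarrow> w \<in> A \<Longrightarrow> \<bar>e p w\<bar> \<le> 1"
    and flip: "\<And>p q. p \<in> P \<Longrightarrow> q \<in> P \<Longrightarrow> (p, q) \<notin> Q \<Longrightarrow>
      \<exists>g. bij_betw g A A \<and> (\<forall>w\<in>A. e p (g w) * e q (g w) = - (e p w * e q w))"
  shows "(\<Sum>w\<in>A. (\<Sum>p\<in>P. e p w)\<^sup>2) \<le> card A * card Q"
proof -
  define c where "c = (\<lambda>(p, q). \<Sum>w\<in>A. e p w * e q w)"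
  have zero: "c x = 0" if "x \<in> P \<times> P - Q" for x
  proof -
    obtain p q where x: "x = (p, q)" "p \<in> P" "q \<in> P" "(p, q) \<notin> Q" using \<open>x \<in> _\<close> by auto
    then obtain g where g: "bij_betw g A A"
      and neg: "\<And>w. w \<in> A \<Longrightarrow> e p (g w) * e q (g w) = - (e p w * e q w)"
      using flip by blast
    have "(\<Sum>w\<in>A. e p w * e q w) = (\<Sum>w\<in>A. e p (g w) * e q (g w))"
      using sum.reindex_bij_betw[OF g, of "\<lambda>w. e p w * e q w"] by simp
    also have "\<dots> = - (\<Sum>w\<in>A. e p w * e q w)"
      using neg by (simp add: sum_negf)
    finally show ?thesis by (simp add: c_def x)
  qed
  have le: "c x \<le> card A" if "x \<in> P \<times> P" for x
  proof -
    obtain p q where x: "x = (p, q)" "p \<in> P" "q \<in> P" using \<open>x \<in> _\<close> by auto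
    have "(\<Sum>w\<in>A. e p w * e q w) \<le> (\<Sum>w\<in>A. 1)"
    proof (rule sum_mono)
      fix w assume "w \<in> A"
      then have "\<bar>e p w * e q w\<bar> \<le> 1 * 1"
        unfolding abs_mult using bound x by (intro mult_mono) auto
      then show "e p w * e q w \<le> 1" by simp
    qed
    then show ?thesis by (simp add: c_def x)
  qed
  have "(\<Sum>w\<in>A. (\<Sum>p\<in>P. e p w)\<^sup>2) = (\<Sum>w\<in>A. \<Sum>x\<in>P \<times> P. e (fst x) w * e (snd x) w)"
    by (simp add: power2_eq_square sum_product sum.cartesian_product case_prod_unfold)
  also have "\<dots> = (\<Sum>x\<in>P \<times> P. c x)"
    unfolding c_def by (subst sum.swap) (simp add: case_prod_unfold)
  also have "\<dots> = (\<Sum>x\<in>(P \<times> P) \<inter> Q. c x)"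
    using assms zero by (intro sum.mono_neutral_right) auto
  also have "\<dots> \<le> (\<Sum>x\<in>(P \<times> P) \<inter> Q. real (card A))"
    using le by (intro sum_mono) auto
  also have "\<dots> \<le> card A * card Q"
    using assms(3) card_mono[of Q "(P \<times> P) \<inter> Q"]
    by (simp add: mult.commute mult_left_mono)
  finally show ?thesis by simp
qed

lemma chebyshev_count:
  fixes f :: "'w \<Rightarrow> real" and a :: real
  assumes "finite A" "a \<ge> 0"
  shows "card {w \<in> A. a \<le> \<bar>f w\<bar>} * a\<^sup>2 \<le> (\<Sum>w\<in>A. (f w)\<^sup>2)"
proof -
  have "card {w \<in> A. a \<le> \<bar>f w\<bar>} * a\<^sup>2 = (\<Sum>w\<in>{w \<in> A. a \<le> \<bar>f w\<bar>}. a\<^sup>2)" by simp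
  also have "\<dots> \<le> (\<Sum>w\<in>{w \<in> A. a \<le> \<bar>f w\<bar>}. (f w)\<^sup>2)"
    using assms(2) by (intro sum_mono) (auto simp flip: abs_le_square_iff)
  also have "\<dots> \<le> (\<Sum>w\<in>A. (f w)\<^sup>2)"
    using assms by (intro sum_mono2) auto
  finally show ?thesis .
qed

context coxeter_system
begin

definition descent_sign :: "nat \<Rightarrow> 'a \<Rightarrow> real" where
  "descent_sign j w = (if j \<in> left_descents w then 1 else - 1)"

lemma sum_descent_sign:
  "(\<Sum>j\<in>gens. descent_sign j w) = 2 * real (card (left_descents w)) - real N"
proof -
  have eq: "left_descents w = gens \<inter> left_descents w" by (auto simp: left_descents_def)
  have "(\<Sum>j\<in>gens. descent_sign j w) =
      (\<Sum>j\<in>gens. 2 * (if j \<in> left_descents w then 1 else 0) - 1)"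
    by (intro sum.cong) (auto simp: descent_sign_def)
  also have "\<dots> = 2 * real (card (left_descents w)) - real N"
    by (subst (2) eq) (simp add: sum_subtractf sum.If_cases flip: sum_distrib_left)
  finally show ?thesis .
qed

lemma sum_descent_sign_group:
  assumes "j \<in> gens"
  shows "(\<Sum>w\<in>carrier W. descent_sign j w) = 0"
proof -
  have "(\<Sum>w\<in>carrier W. descent_sign j w) = (\<Sum>w\<in>carrier W. descent_sign j (s j \<otimes> w))"
    using sum.reindex_bij_betw[OF bij_left_mult[of "s j"], of "descent_sign j"] assms by simp
  also have "\<dots> = (\<Sum>w\<in>carrier W. - descent_sign j w)"
    using assms by (intro sum.cong) (auto simp: descent_sign_def descent_self)
  finally show ?thesis by (simp add: sum_negf)
qed

text \<open>The surviving pairs are equal or noncommuting generators: for any other pair, left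
  multiplication by \<open>s j\<close> reverses the sign of \<open>j\<close> and keeps that of
  \<open>k\<close>.\<close>

lemma descents_concentrated:
  fixes a :: real
  assumes "finite (carrier W)" "a \<ge> 0"
  shows "card {w \<in> carrier W. a \<le> \<bar>2 * real (card (left_descents w)) - real N\<bar>} * a\<^sup>2
    \<le> card (carrier W) * card {(j, k). j \<in> gens \<and> k \<in> gens \<and> (j = k \<or> m j k \<noteq> 2)}"
    (is "_ \<le> real (_ * card ?Q)")
proof -
  have "(\<Sum>w\<in>carrier W. (\<Sum>j\<in>gens. descent_sign j w)\<^sup>2) \<le> card (carrier W) * card ?Q"
  proof (rule second_moment_bound)
    show "finite ?Q" by (rule finite_subset[of _ "gens \<times> gens"]) auto
    fix j k assume jk: "j \<in> gens" "k \<in> gens" "(j, k) \<notin> ?Q"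
    show "\<exists>g. bij_betw g (carrier W) (carrier W) \<and> (\<forall>w\<in>carrier W.
        descent_sign j (g w) * descent_sign k (g w) = - (descent_sign j w * descent_sign k w))"
      using jk by (intro exI[of _ "\<lambda>w. s j \<otimes> w"])
        (auto simp: bij_left_mult descent_sign_def descent_self descent_commuting)
  qed (use assms in \<open>auto simp: descent_sign_def\<close>)
  with chebyshev_count[OF assms, of "\<lambda>w. \<Sum>j\<in>gens. descent_sign j w"]
  show ?thesis unfolding sum_descent_sign by (rule order_trans)
qed

text \<open>The bound on lengths makes the \<open>ARG_MAX\<close> in \<open>longest\<close>
  attained, and \<open>x \<le> N\<close> makes the set under \<open>Max\<close> nonempty.\<close>

lemma maxw0_le:
  assumes "x \<le> N" and bound: "\<And>I w. I \<subseteq> gens \<Longrightarrow> card I = x \<Longrightarrow> w \<in> parabolic I \<Longrightarrow> cox_length w \<le> L"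
  shows "maxw0 x \<le> L"
proof -
  have le: "cox_length (longest I) \<le> L" if "I \<subseteq> gens" "card I = x" for I
  proof -
    have "longest I \<in> parabolic I"
      unfolding longest_def
    proof (rule arg_max_natI)
      show "\<one> \<in> parabolic I" by (simp add: parabolic_def generate.one)
      show "\<forall>y. y \<in> parabolic I \<longrightarrow> cox_length y < Suc L"
        using bound[OF that] by (simp add: less_Suc_eq_le)
    qed
    then show ?thesis using bound[OF that] by simp
  qed
  have "finite {cox_length (longest I) |I. I \<subseteq> gens \<and> card I = x}"
    by (rule finite_subset[of _ "(\<lambda>I. cox_length (longest I)) ` Pow gens"]) auto
  moreover obtain I where "I \<subseteq> gens" "card I = x"
    using obtain_subset_with_card_n[of x gens] assms(1) by auto
  ultimately show ?thesis
    unfolding maxw0_def using le by (subst Max_le_iff) auto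
qed

end

text \<open>The generators act on the integers by \<open>\<sigma>\<close>, and \<open>\<tau> p\<close> is a reflection exchanging the two
  entries of \<open>p\<close>. If \<open>\<tau> p\<close> fixes the entries of \<open>q\<close>, then right multiplication by it reverses the
  pair \<open>p\<close> but not \<open>q\<close>, so the two inversion events are uncorrelated.\<close>

locale inversion_action = coxeter_system +
  fixes \<sigma> :: "nat \<Rightarrow> int \<Rightarrow> int" and P :: "(int \<times> int) set" and c :: nat
    and \<tau> :: "int \<times> int \<Rightarrow> int \<Rightarrow> int" and Q :: "((int \<times> int) \<times> int \<times> int) set"
  assumes action_inj: "\<And>i. i \<in> {1..N} \<Longrightarrow> inj (\<sigma> i)"
    and action_relator: "\<And>i j. i \<in> {1..N} \<Longrightarrow> j \<in> {1..N} \<Longrightarrow>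
      foldr \<sigma> (concat (replicate (m i j) [i, j])) = id"
    and finite_P: "finite P" and finite_Q: "finite Q"
    and P_less: "\<And>a b. (a, b) \<in> P \<Longrightarrow> a < b"
    and P_closed: "\<And>i a b. i \<in> {1..N} \<Longrightarrow> (a, b) \<in> P \<Longrightarrow>
      (\<sigma> i a, \<sigma> i b) \<in> P \<or> (\<sigma> i b, \<sigma> i a) \<in> P"
    and gen_inversions: "\<And>i. i \<in> {1..N} \<Longrightarrow> card {(a, b) \<in> P. \<sigma> i b < \<sigma> i a} \<le> c"
    and reflection_word: "\<And>p. p \<in> P \<Longrightarrow> \<exists>u. set u \<subseteq> {1..N} \<and> foldr \<sigma> u = \<tau> p"
    and reflection_swap: "\<And>a b. (a, b) \<in> P \<Longrightarrow> \<tau> (a, b) a = b \<and> \<tau> (a, b) b = a"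
    and reflection_fix: "\<And>p a b. p \<in> P \<Longrightarrow> (a, b) \<in> P \<Longrightarrow> (p, (a, b)) \<notin> Q \<Longrightarrow>
      \<tau> p a = a \<and> \<tau> p b = b"
begin

lemma foldr_append_comp: "foldr \<sigma> (u @ v) = foldr \<sigma> u \<circ> foldr \<sigma> v"
  by (induction u) auto

lemma foldr_inj: "set u \<subseteq> gens \<Longrightarrow> inj (foldr \<sigma> u)"
  by (induction u) (auto intro!: inj_compose action_inj)

text \<open>The choice of word is harmless: \<open>\<sigma>\<close> satisfies the relators, so all
  words for \<open>w\<close> give the same map.\<close>

definition act :: "'a \<Rightarrow> int \<Rightarrow> int" where
  "act w = foldr \<sigma> (SOME u. set u \<subseteq> gens \<and> wp u = w)"

lemma act_wp: "set u \<subseteq> gens \<Longrightarrow> act (wp u) = foldr \<sigma> u"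
proof -
  assume u: "set u \<subseteq> gens"
  let ?v = "SOME v. set v \<subseteq> gens \<and> wp v = wp u"
  have v: "set ?v \<subseteq> gens \<and> wp ?v = wp u"
    by (rule someI[of "\<lambda>v. set v \<subseteq> gens \<and> wp v = wp u" u]) (use u in auto)
  have "foldr \<sigma> ?v = foldr \<sigma> u"
    by (rule word_invariant) (use u v in \<open>auto simp: foldr_append_comp action_relator\<close>)
  then show ?thesis by (simp add: act_def)
qed

lemma act_inj: "w \<in> carrier W \<Longrightarrow> inj (act w)"
  by (metis word_of act_wp foldr_inj)

lemma act_mult: "x \<in> carrier W \<Longrightarrow> y \<in> carrier W \<Longrightarrow> act (x \<otimes> y) = act x \<circ> act y"
proof -
  assume "x \<in> carrier W" "y \<in> carrier W"
  then obtain u v where "set u \<subseteq> gens" "wp u = x" "set v \<subseteq> gens" "wp v = y"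
    by (metis word_of)
  then show ?thesis using act_wp[of "u @ v"] act_wp[of u] act_wp[of v]
    by (auto simp: wp_append foldr_append_comp)
qed

definition inversions :: "(int \<Rightarrow> int) \<Rightarrow> (int \<times> int) set" where
  "inversions f = {(a, b) \<in> P. f b < f a}"

lemma finite_inversions: "finite (inversions f)"
  by (rule finite_subset[OF _ finite_P]) (auto simp: inversions_def)

text \<open>A pair inverted by \<open>f \<circ> \<sigma> i\<close> is either among the at most
  \<open>c\<close> pairs inverted by \<open>\<sigma> i\<close>, or keeps its order and is sent
  injectively to an inversion of \<open>f\<close>.\<close>

lemma inversions_comp:
  assumes "i \<in> gens"
  shows "card (inversions (f \<circ> \<sigma> i)) \<le> c + card (inversions f)"
proof -
  let ?E = "inversions (\<sigma> i)"
  let ?D = "inversions (f \<circ> \<sigma> i) - ?E"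
  have "map_prod (\<sigma> i) (\<sigma> i) ` ?D \<subseteq> inversions f"
    using P_closed[OF assms] P_less by (force simp: inversions_def)
  moreover have "inj_on (map_prod (\<sigma> i) (\<sigma> i)) ?D"
    using action_inj[OF assms] by (auto simp: inj_on_def)
  ultimately have "card ?D \<le> card (inversions f)"
    by (metis card_image card_mono finite_inversions)
  moreover have "card (inversions (f \<circ> \<sigma> i)) \<le> card (?E \<union> ?D)"
    by (intro card_mono) (auto simp: finite_inversions)
  moreover have "card (?E \<union> ?D) \<le> card ?E + card ?D" by (rule card_Un_le)
  moreover have "card ?E \<le> c" using gen_inversions[OF assms] by (simp add: inversions_def)
  ultimately show ?thesis by linarith
qed

lemma inversions_le_length:
  assumes "w \<in> carrier W"
  shows "card (inversions (act w)) \<le> c * cox_length w"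
proof -
  have "card (inversions (foldr \<sigma> u)) \<le> c * length u" if "set u \<subseteq> gens" for u
    using that
  proof (induction u rule: rev_induct)
    case Nil
    have "inversions (foldr \<sigma> []) = {}" using P_less by (force simp: inversions_def)
    then show ?case by (simp only: card.empty)
  next
    case (snoc i u)
    have comp: "foldr \<sigma> (u @ [i]) = foldr \<sigma> u \<circ> \<sigma> i" by (auto simp: foldr_append_comp)
    have "card (inversions (foldr \<sigma> (u @ [i]))) \<le> c + card (inversions (foldr \<sigma> u))"
      unfolding comp using snoc.prems by (intro inversions_comp) auto
    also have "\<dots> \<le> c + c * length u" using snoc by simp
    also have "\<dots> = c * length (u @ [i])" by simp
    finally show ?case .
  qed
  then show ?thesis using reduced_word[OF assms] by (metis act_wp)
qed

definition inversion_sign :: "int \<times> int \<Rightarrow> 'a \<Rightarrow> real" where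
  "inversion_sign p w = (if act w (snd p) < act w (fst p) then - 1 else 1)"

lemma sum_inversion_sign:
  "(\<Sum>p\<in>P. inversion_sign p w) = real (card P) - 2 * real (card (inversions (act w)))"
proof -
  have eq: "inversions (act w) = {p \<in> P. act w (snd p) < act w (fst p)}"
    by (auto simp: inversions_def)
  have "(\<Sum>p\<in>P. inversion_sign p w) =
      (\<Sum>p\<in>P. 1 - 2 * (if act w (snd p) < act w (fst p) then 1 else 0))"
    by (intro sum.cong) (auto simp: inversion_sign_def)
  also have "\<dots> = real (card P) - 2 * real (card (inversions (act w)))"
    unfolding eq using finite_P
    by (simp add: sum_subtractf sum.If_cases Int_def flip: sum_distrib_left)
  finally show ?thesis .
qed

lemma inversions_concentrated:
  fixes a :: real
  assumes "finite (carrier W)" "a \<ge> 0"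
  shows "card {w \<in> carrier W. a \<le> \<bar>real (card P) - 2 * real (card (inversions (act w)))\<bar>} * a\<^sup>2
    \<le> card (carrier W) * card Q"
proof -
  have "(\<Sum>w\<in>carrier W. (\<Sum>p\<in>P. inversion_sign p w)\<^sup>2) \<le> card (carrier W) * card Q"
  proof (rule second_moment_bound)
    fix p q assume pq: "p \<in> P" "q \<in> P" "(p, q) \<notin> Q"
    obtain a b where p: "p = (a, b)" by (cases p)
    obtain a' b' where q: "q = (a', b')" by (cases q)
    obtain u where u: "set u \<subseteq> gens" "foldr \<sigma> u = \<tau> p" using reflection_word pq by blast
    have t: "wp u \<in> carrier W" using u by simp
    have "inversion_sign p (w \<otimes> wp u) * inversion_sign q (w \<otimes> wp u) =
        - (inversion_sign p w * inversion_sign q w)" if w: "w \<in> carrier W" for w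
    proof -
      have act: "act (w \<otimes> wp u) = act w \<circ> \<tau> p" using act_mult[OF w t] u by (simp add: act_wp)
      \<comment> \<open>Injectivity excludes ties, so exchanging \<open>a\<close> and
        \<open>b\<close> really reverses the sign.\<close>
      have "act w a \<noteq> act w b" using act_inj[OF w] P_less[of a b] pq p by (auto dest: injD)
      then show ?thesis
        using reflection_swap[of a b] reflection_fix[of p a' b'] pq p q
        by (auto simp: inversion_sign_def act)
    qed
    then show "\<exists>g. bij_betw g (carrier W) (carrier W) \<and> (\<forall>w\<in>carrier W.
        inversion_sign p (g w) * inversion_sign q (g w) =
        - (inversion_sign p w * inversion_sign q w))"
      using bij_right_mult[OF t] by blast
  qed (use assms finite_P finite_Q in \<open>auto simp: inversion_sign_def\<close>)
  then show ?thesis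
    using chebyshev_count[OF assms, of "\<lambda>w. \<Sum>p\<in>P. inversion_sign p w"]
    by (simp add: sum_inversion_sign)
qed

end

section \<open>Parabolic subgroups of the classical types\<close>

context coxeter_system
begin

lemma braid3:
  assumes "i \<in> gens" "j \<in> gens" "m i j = 3"
  shows "s i \<otimes> (s j \<otimes> s i) = s j \<otimes> (s i \<otimes> s j)"
proof -
  have "s i \<otimes> (s j \<otimes> (s i \<otimes> (s j \<otimes> (s i \<otimes> s j)))) = \<one>"
    using wp_relator[of i j] assms by (simp add: numeral_3_eq_3)
  then have "(s i \<otimes> (s j \<otimes> s i)) \<otimes> (s j \<otimes> (s i \<otimes> s j)) = \<one>"
    using assms by (simp add: m_assoc)
  then have "inv (s j \<otimes> (s i \<otimes> s j)) = s i \<otimes> (s j \<otimes> s i)"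
    using assms by (intro inv_equality) auto
  then show ?thesis using assms by (simp add: inv_mult_group m_assoc)
qed

lemma braid4:
  assumes "i \<in> gens" "j \<in> gens" "m i j = 4"
  shows "s i \<otimes> (s j \<otimes> (s i \<otimes> s j)) = s j \<otimes> (s i \<otimes> (s j \<otimes> s i))"
proof -
  have "s i \<otimes> (s j \<otimes> (s i \<otimes> (s j \<otimes> (s i \<otimes> (s j \<otimes> (s i \<otimes> s j)))))) = \<one>"
    using wp_relator[of i j] assms by (simp add: eval_nat_numeral)
  then have "(s i \<otimes> (s j \<otimes> (s i \<otimes> s j))) \<otimes> (s i \<otimes> (s j \<otimes> (s i \<otimes> s j))) = \<one>"
    using assms by (simp add: m_assoc)
  then have "inv (s i \<otimes> (s j \<otimes> (s i \<otimes> s j))) = s i \<otimes> (s j \<otimes> (s i \<otimes> s j))"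
    using assms by (intro inv_equality) auto
  then show ?thesis using assms by (simp add: inv_mult_group m_assoc)
qed

lemma commute_word:
  assumes "k \<in> gens" "set u \<subseteq> gens" "\<And>i. i \<in> set u \<Longrightarrow> m i k = 2"
  shows "wp u \<otimes> s k = s k \<otimes> wp u"
  using assms(2,3)
proof (induction u)
  case (Cons i u)
  have "wp (i # u) \<otimes> s k = s i \<otimes> (s k \<otimes> wp u)"
    using Cons assms(1) by (simp add: m_assoc)
  also have "\<dots> = s k \<otimes> (s i \<otimes> wp u)"
    using Cons.prems assms(1) gens_commute[of i k] by (simp flip: m_assoc)
  finally show ?case by simp
qed (use assms(1) in simp)

lemma wp_rev: "set u \<subseteq> gens \<Longrightarrow> wp (rev u) = inv (wp u)"
  by (induction u) (auto simp: wp_append inv_mult_group)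

text \<open>The products of an element of \<open>parabolic (I - {i})\<close> and an element of
  \<open>C\<close> include the identity and are closed under right multiplication by the generators
  in \<open>I\<close>, so they exhaust \<open>parabolic I\<close>.\<close>

lemma parabolic_chain_bound:
  assumes I: "I \<subseteq> gens" and C: "\<one> \<in> C" "C \<subseteq> carrier W"
    and closed: "\<And>c k. c \<in> C \<Longrightarrow> k \<in> I \<Longrightarrow>
      c \<otimes> s k \<in> C \<or> (\<exists>j\<in>I - {i}. c \<otimes> s k = s j \<otimes> c)"
    and B: "\<And>c. c \<in> C \<Longrightarrow> cox_length c \<le> B"
    and L: "\<And>h. h \<in> parabolic (I - {i}) \<Longrightarrow> cox_length h \<le> L"
    and w: "w \<in> parabolic I"
  shows "cox_length w \<le> L + B"
proof -
  have "\<exists>h\<in>parabolic (I - {i}). \<exists>c\<in>C. wp u = h \<otimes> c" if "set u \<subseteq> I" for u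
    using that
  proof (induction u rule: rev_induct)
    case Nil
    have "\<one> \<in> parabolic (I - {i})" by (simp add: parabolic_def generate.one)
    then show ?case using C by force
  next
    case (snoc k u)
    then obtain h c where hc: "h \<in> parabolic (I - {i})" "c \<in> C" "wp u = h \<otimes> c" by auto
    have k: "k \<in> I" "k \<in> gens" and u: "set u \<subseteq> gens" using snoc.prems I by auto
    have "parabolic (I - {i}) \<subseteq> carrier W"
      unfolding parabolic_def using I by (intro generate_incl) auto
    then have carr: "h \<in> carrier W" "c \<in> carrier W" using hc C by auto
    have *: "wp (u @ [k]) = h \<otimes> (c \<otimes> s k)"
      using u k hc carr by (simp add: wp_append m_assoc)
    from closed[OF hc(2) k(1)] show ?case
    proof
      assume "\<exists>j\<in>I - {i}. c \<otimes> s k = s j \<otimes> c"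
      then obtain j where j: "j \<in> I - {i}" "c \<otimes> s k = s j \<otimes> c" by auto
      then have "h \<otimes> s j \<in> parabolic (I - {i})"
        using hc(1) unfolding parabolic_def by (auto intro: generate.eng generate.incl)
      moreover have "wp (u @ [k]) = (h \<otimes> s j) \<otimes> c"
        using * j carr I by (auto simp: m_assoc subset_iff)
      ultimately show ?thesis using hc by blast
    qed (use * hc in blast)
  qed
  moreover obtain u where "set u \<subseteq> I" "wp u = w" using word_in_parabolic[OF I w] .
  ultimately obtain h c where hc: "h \<in> parabolic (I - {i})" "c \<in> C" "w = h \<otimes> c" by blast
  have "parabolic (I - {i}) \<subseteq> carrier W"
    unfolding parabolic_def using I by (intro generate_incl) auto
  then have "cox_length w \<le> cox_length h + cox_length c"
    using cox_length_mult[of h c] hc C by auto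
  also have "\<dots> \<le> L + B" using B L hc by (intro add_mono) auto
  finally show ?thesis .
qed

end

text \<open>A path \<open>1, \<dots>, l\<close> whose last node is joined to \<open>N - l\<close> further, pairwise commuting nodes:
  none for \<open>A\<^sub>n\<close>, one (by an edge labelled \<open>4\<close>) for \<open>B\<^sub>n\<close>, two for \<open>D\<^sub>n\<close>.\<close>

locale branched_path = coxeter_system +
  fixes l :: nat
  assumes l_bounds: "1 \<le> l" "l \<le> N" "N \<le> l + 2"
    and labels: "\<And>i j. 1 \<le> i \<Longrightarrow> i < j \<Longrightarrow> j \<le> N \<Longrightarrow>
      m i j = (if j \<le> l then (if j = i + 1 then 3 else 2)
               else if i = l then (if N = l + 1 then 4 else 3) else 2)"
begin

section \<open>Conjugation along the path and coset chains\<close>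

lemma matrix_nonadjacent:
  assumes "1 \<le> i" "i < k" "k \<le> N" "k \<le> l \<Longrightarrow> i + 1 < k" "l < k \<Longrightarrow> i \<noteq> l"
  shows "m i k = 2" "m k i = 2"
proof -
  show "m i k = 2" using labels[of i k] assms by auto
  then show "m k i = 2" using matrix_sym[of i k] assms by auto
qed

text \<open>The path word acts on generators like a long cycle: \<open>s k\<close> commutes past the
  letters above \<open>k + 1\<close>, the braid relation turns it into \<open>s (k + 1)\<close>, and
  this commutes past the letters below \<open>k\<close>.\<close>

lemma up_shift:
  assumes "1 \<le> i" "i \<le> k" "k < p" "p \<le> l"
  shows "wp [i..<Suc p] \<otimes> s k = s (Suc k) \<otimes> wp [i..<Suc p]"
proof -
  let ?A = "wp [i..<k]" and ?B = "wp [Suc (Suc k)..<Suc p]"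
  have k: "k \<in> gens" "Suc k \<in> gens" using assms l_bounds by auto
  have sets: "set [i..<k] \<subseteq> gens" "set [Suc (Suc k)..<Suc p] \<subseteq> gens"
    using assms l_bounds by auto
  have carr: "?A \<in> carrier W" "?B \<in> carrier W" using sets by auto
  have "[i..<Suc p] = [i..<k] @ k # Suc k # [Suc (Suc k)..<Suc p]"
    using assms by (metis Suc_lessD Suc_lessI Suc_mono le_Suc_ex less_SucI upt_add_eq_append upt_conv_Cons
        order_less_imp_le le_add_diff_inverse)
  then have U: "wp [i..<Suc p] = ?A \<otimes> (s k \<otimes> (s (Suc k) \<otimes> ?B))"
    using sets k by (simp add: wp_append del: upt_Suc)
  have A: "?A \<otimes> s (Suc k) = s (Suc k) \<otimes> ?A"
    using assms l_bounds by (intro commute_word matrix_nonadjacent) auto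
  have B: "?B \<otimes> s k = s k \<otimes> ?B"
    using assms l_bounds by (intro commute_word matrix_nonadjacent) auto
  have br: "s k \<otimes> (s (Suc k) \<otimes> s k) = s (Suc k) \<otimes> (s k \<otimes> s (Suc k))"
    using assms l_bounds labels[of k "Suc k"] by (intro braid3) auto
  have "wp [i..<Suc p] \<otimes> s k = ?A \<otimes> (s k \<otimes> (s (Suc k) \<otimes> (?B \<otimes> s k)))"
    using U carr k by (simp add: m_assoc)
  also have "\<dots> = ?A \<otimes> ((s k \<otimes> (s (Suc k) \<otimes> s k)) \<otimes> ?B)"
    unfolding B using carr k by (simp add: m_assoc)
  also have "\<dots> = (?A \<otimes> s (Suc k)) \<otimes> (s k \<otimes> (s (Suc k) \<otimes> ?B))"
    unfolding br using carr k by (simp add: m_assoc)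
  also have "\<dots> = s (Suc k) \<otimes> wp [i..<Suc p]"
    unfolding A U using carr k by (simp add: m_assoc)
  finally show ?thesis .
qed

lemma down_shift:
  assumes "1 \<le> q" "q < k" "k \<le> p" "p \<le> l"
  shows "wp (rev [q..<Suc p]) \<otimes> s k = s (k - 1) \<otimes> wp (rev [q..<Suc p])"
proof -
  let ?U = "wp [q..<Suc p]"
  have set: "set [q..<Suc p] \<subseteq> gens" and k: "k \<in> gens" "k - 1 \<in> gens"
    using assms l_bounds by auto
  have "?U \<otimes> s (k - 1) = s k \<otimes> ?U" using up_shift[of q "k - 1" p] assms by simp
  then have "inv (?U \<otimes> s (k - 1)) = inv (s k \<otimes> ?U)" by simp
  then show ?thesis
    using set k wp_closed[OF set] by (simp only: inv_mult_group wp_rev gen_in_carrier inv_gen)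
qed

abbreviation tail :: "nat list" where "tail \<equiv> [Suc l..<Suc N]"

lemma tail_set: "set tail \<subseteq> gens" using l_bounds by auto

lemma tail_commute: "1 \<le> k \<Longrightarrow> k < l \<Longrightarrow> wp tail \<otimes> s k = s k \<otimes> wp tail"
  using l_bounds by (intro commute_word matrix_nonadjacent) auto

text \<open>Conjugation by \<open>s l \<otimes> wp tail \<otimes> s l\<close> preserves the end
  nodes: in type B it fixes the only one, by the relation with label 4; in type D it exchanges the
  two.\<close>

lemma tail_conjugate:
  assumes "l < k" "k \<le> N"
  shows "\<exists>j. l < j \<and> j \<le> N \<and> s l \<otimes> wp tail \<otimes> s l \<otimes> s k = s j \<otimes> (s l \<otimes> wp tail \<otimes> s l)"
proof (cases "N = Suc l")
  case True
  then have "k = N" using assms by simp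
  moreover have "m l N = 4" using labels[of l N] True l_bounds by auto
  ultimately show ?thesis
    using True l_bounds braid4[of l N] by (intro exI[of _ N]) (auto simp: m_assoc)
next
  case False
  then have N: "N = Suc (Suc l)" using assms l_bounds by simp
  define a where "a = Suc l"
  define b where "b = Suc (Suc l)"
  have g: "l \<in> gens" "a \<in> gens" "b \<in> gens" using N l_bounds by (auto simp: a_def b_def)
  have mm: "m l a = 3" "m l b = 3" "m a b = 2"
    using labels[of l a] labels[of l b] labels[of a b] N l_bounds by (auto simp: a_def b_def)
  have t: "wp tail = s a \<otimes> s b" using g N by (simp add: a_def b_def)
  have ab: "s a \<otimes> s b = s b \<otimes> s a" using gens_commute g mm by simp
  have la: "s a \<otimes> (s l \<otimes> s a) = s l \<otimes> (s a \<otimes> s l)" using braid3[of l a] g mm by simp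
  have lb: "s b \<otimes> (s l \<otimes> s b) = s l \<otimes> (s b \<otimes> s l)" using braid3[of l b] g mm by simp
  have key: "s l \<otimes> (x \<otimes> y) \<otimes> s l \<otimes> y = x \<otimes> (s l \<otimes> (x \<otimes> y) \<otimes> s l)"
    if xy: "x \<in> carrier W" "y \<in> carrier W"
      and x: "x \<otimes> (s l \<otimes> x) = s l \<otimes> (x \<otimes> s l)" and y: "y \<otimes> (s l \<otimes> y) = s l \<otimes> (y \<otimes> s l)" for x y
  proof -
    have "s l \<otimes> (x \<otimes> y) \<otimes> s l \<otimes> y = s l \<otimes> (x \<otimes> (y \<otimes> (s l \<otimes> y)))"
      using xy g by (simp add: m_assoc)
    also have "\<dots> = (s l \<otimes> (x \<otimes> s l)) \<otimes> (y \<otimes> s l)"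
      unfolding y using xy g by (simp add: m_assoc)
    also have "\<dots> = x \<otimes> (s l \<otimes> (x \<otimes> y) \<otimes> s l)"
      unfolding x[symmetric] using xy g by (simp add: m_assoc)
    finally show ?thesis .
  qed
  consider "k = a" | "k = b" using assms N by (force simp: a_def b_def)
  then show ?thesis
  proof cases
    case 1
    have "s l \<otimes> wp tail \<otimes> s l \<otimes> s a = s b \<otimes> (s l \<otimes> wp tail \<otimes> s l)"
      unfolding t ab using g la lb by (intro key) auto
    then show ?thesis using 1 N by (intro exI[of _ b]) (auto simp: b_def)
  next
    case 2
    have "s l \<otimes> wp tail \<otimes> s l \<otimes> s b = s a \<otimes> (s l \<otimes> wp tail \<otimes> s l)"
      unfolding t using g la lb by (intro key) auto
    then show ?thesis using 2 N by (intro exI[of _ a]) (auto simp: a_def)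
  qed
qed

text \<open>For \<open>i = Min I\<close> the words of \<open>chain i\<close> over \<open>I\<close> represent the cosets of \<open>W\<^bsub>I - {i}\<^esub>\<close> in
  \<open>W\<^sub>I\<close>: go up the path from \<open>i\<close>, through the tail, and back down.\<close>

definition chain :: "nat \<Rightarrow> nat list set" where
  "chain i = (\<lambda>q. [i..<q]) ` {i..Suc l} \<union> (\<lambda>k. [i..<Suc l] @ [k]) ` {Suc l..N}
     \<union> (if l < N then (\<lambda>q. [i..<Suc l] @ tail @ rev [q..<Suc l]) ` {i..Suc l} else {})"

lemma chain_intros:
  "i \<le> q \<Longrightarrow> q \<le> Suc l \<Longrightarrow> [i..<q] \<in> chain i"
  "l < k \<Longrightarrow> k \<le> N \<Longrightarrow> [i..<Suc l] @ [k] \<in> chain i"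
  "i \<le> q \<Longrightarrow> q \<le> Suc l \<Longrightarrow> l < N \<Longrightarrow> [i..<Suc l] @ tail @ rev [q..<Suc l] \<in> chain i"
  unfolding chain_def by (intro UnI1 UnI2 image_eqI[OF refl]; simp del: upt_Suc)+

text \<open>This is the closure required by \<open>parabolic_chain_bound\<close>. Either
  \<open>s k\<close> leads to another chain word, or it travels to the left end and emerges as a
  generator other than \<open>s i\<close>. A node beyond the end of a path word and not adjacent to
  it commutes with it, which covers sets \<open>I\<close> with gaps.\<close>

lemma chain_closed:
  assumes I: "I \<subseteq> gens" "i \<in> I" "\<And>x. x \<in> I \<Longrightarrow> i \<le> x" and i: "i \<le> l" and k: "k \<in> I"
    and u: "u \<in> chain i" "set u \<subseteq> I"
  shows "wp u \<otimes> s k \<in> wp ` {v \<in> chain i. set v \<subseteq> I} \<or> (\<exists>j\<in>I - {i}. wp u \<otimes> s k = s j \<otimes> wp u)"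
    (is "?G")
proof -
  have i1: "1 \<le> i" and k1: "k \<in> gens" "i \<le> k" "k \<le> N" using I k by auto
  have up_set: "set [i..<q] \<subseteq> gens" if "q \<le> Suc l" for q using that i1 l_bounds by auto
  have down_set: "set (rev [q..<Suc l]) \<subseteq> gens" if "i \<le> q" for q using that i1 l_bounds by auto
  have move: ?G if "v \<in> chain i" "set v \<subseteq> I" "wp u \<otimes> s k = wp v" for v
    using that by auto
  have slide: ?G if "j \<in> I" "j \<noteq> i" "wp u \<otimes> s k = s j \<otimes> wp u" for j
    using that by auto
  let ?up = "wp [i..<Suc l]"
  have up: "?up \<in> carrier W" using up_set[of "Suc l"] by (intro wp_closed) auto
  consider (path) q where "u = [i..<q]" "i \<le> q" "q \<le> Suc l"
    | (branch) b where "u = [i..<Suc l] @ [b]" "l < b" "b \<le> N"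
    | (return) q where "u = [i..<Suc l] @ tail @ rev [q..<Suc l]" "i \<le> q" "q \<le> Suc l" "l < N"
    using u(1) by (auto simp: chain_def simp del: upt_Suc split: if_splits)
  then show ?thesis
  proof cases
    case path
    have sub: "{i..<q} \<subseteq> I" using u path by auto
    have uq: "wp [i..<Suc k] = wp u \<otimes> s k" if "k = q"
      using that path up_set[of q] k1 by (simp add: wp_append)
    consider "k = q" "k \<le> l" | "l < k" "q = Suc l" | "l < k" "q \<le> l" | "q < k" "k \<le> l"
      | "Suc k = q" | "Suc k < q"
      using path by linarith
    then show ?thesis
    proof cases
      case 1
      show ?thesis
      proof (rule move)
        show "[i..<Suc k] \<in> chain i" using 1 k1 path by (auto intro: chain_intros simp del: upt_Suc)
        show "set [i..<Suc k] \<subseteq> I" using sub k 1 by (auto simp: less_Suc_eq)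
      qed (use uq 1 in simp)
    next
      case 2
      show ?thesis
      proof (rule move)
        show "[i..<Suc l] @ [k] \<in> chain i" using 2 k1 by (auto intro: chain_intros simp del: upt_Suc)
        show "set ([i..<Suc l] @ [k]) \<subseteq> I" using sub k 2 by auto
        show "wp u \<otimes> s k = wp ([i..<Suc l] @ [k])"
          using path 2 up_set[of q] k1 by (simp add: wp_append del: upt_Suc)
      qed
    next
      case 3
      have "wp u \<otimes> s k = s k \<otimes> wp u"
        unfolding path(1) using 3 k1 i1 up_set[of q] path(3)
        by (intro commute_word matrix_nonadjacent(1)) auto
      then show ?thesis using slide[of k] 3 k path i by auto
    next
      case 4
      have "wp u \<otimes> s k = s k \<otimes> wp u"
        unfolding path(1) using 4 k1 i1 up_set[of q] path(3)
        by (intro commute_word matrix_nonadjacent(1)) auto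
      then show ?thesis using slide[of k] 4 k path i by auto
    next
      case 5
      show ?thesis
      proof (rule move)
        show "[i..<k] \<in> chain i" using 5 k1 path by (auto intro: chain_intros simp del: upt_Suc)
        show "set [i..<k] \<subseteq> I" using sub 5 by auto
        have "wp u = wp [i..<k] \<otimes> s k"
          using path 5 up_set[of k] k1 by (auto simp: wp_append)
        moreover have "wp [i..<k] \<in> carrier W" using path 5 by (intro wp_closed up_set) auto
        ultimately show "wp u \<otimes> s k = wp [i..<k]" using k1 by simp
      qed
    next
      case 6
      then obtain p where p: "q = Suc p" "k < p" by (cases q) auto
      show ?thesis
      proof (rule slide)
        show "Suc k \<in> I" using 6 sub k1 by auto
        show "wp u \<otimes> s k = s (Suc k) \<otimes> wp u"
          unfolding path(1) p(1) using p path k1 i1 by (intro up_shift) auto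
      qed (use k1 in auto)
    qed
  next
    case branch
    have sub: "{i..l} \<subseteq> I" "b \<in> I" using u branch by auto
    have b: "b \<in> gens" using branch i1 i by auto
    have u': "wp u = ?up \<otimes> s b"
      unfolding branch(1) using up_set[of "Suc l"] b by (simp add: wp_append del: upt_Suc)
    consider "k < l" | "k = l" "N = Suc l" | "k = l" "N = Suc (Suc l)" | "k = b" | "l < k" "k \<noteq> b"
      using branch l_bounds by linarith
    then show ?thesis
    proof cases
      case 1
      have "m b k = 2" using 1 k1 branch by (intro matrix_nonadjacent) auto
      then have "wp u \<otimes> s k = ?up \<otimes> s k \<otimes> s b"
        unfolding u' using up b k1 gens_commute[of b k] by (simp add: m_assoc)
      also have "?up \<otimes> s k = s (Suc k) \<otimes> ?up"
        using i1 k1 1 by (intro up_shift) auto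
      finally have "wp u \<otimes> s k = s (Suc k) \<otimes> wp u"
        unfolding u' using up b 1 l_bounds by (simp add: m_assoc)
      moreover have "Suc k \<in> I" using sub(1) 1 k1 by auto
      ultimately show ?thesis using slide[of "Suc k"] k1 by auto
    next
      case 2
      have "b = N" using 2 branch by simp
      show ?thesis
      proof (rule move)
        show "[i..<Suc l] @ tail @ rev [l..<Suc l] \<in> chain i"
          by (rule chain_intros) (use 2 i in auto)
        show "set ([i..<Suc l] @ tail @ rev [l..<Suc l]) \<subseteq> I"
          using sub 2 \<open>b = N\<close> i by auto
        have "wp ([i..<Suc l] @ ([N] @ [l])) = ?up \<otimes> (s N \<otimes> s l)"
          using up_set[of "Suc l"] b \<open>b = N\<close> k1 2 by (subst wp_append) auto
        moreover have "tail @ rev [l..<Suc l] = [N] @ [l]" using 2 by simp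
        ultimately show "wp u \<otimes> s k = wp ([i..<Suc l] @ tail @ rev [l..<Suc l])"
          using u' up b k1 2 \<open>b = N\<close> by (simp add: m_assoc del: upt_Suc)
      qed
    next
      \<comment> \<open>Type D: the braid relation between \<open>l\<close> and \<open>b\<close>
        brings \<open>s b\<close> to the front of the last three letters, and it commutes with
        everything before them.\<close>
      case 3
      let ?A = "wp [i..<l]"
      have A: "?A \<in> carrier W" using up_set[of l] by (intro wp_closed) auto
      have up': "?up = ?A \<otimes> s l" using up_set[of l] i k1 3 by (simp add: wp_append)
      have "m l b = 3" using labels[of l b] 3 branch l_bounds by auto
      then have br: "s l \<otimes> (s b \<otimes> s l) = s b \<otimes> (s l \<otimes> s b)"
        using b k1 3 by (intro braid3) auto
      have Ab: "?A \<otimes> s b = s b \<otimes> ?A"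
        using b branch i1 l_bounds by (intro commute_word matrix_nonadjacent) auto
      have "wp u \<otimes> s k = ?A \<otimes> (s l \<otimes> (s b \<otimes> s l))"
        unfolding u' up' using A b k1 3 by (simp add: m_assoc)
      also have "\<dots> = (?A \<otimes> s b) \<otimes> (s l \<otimes> s b)"
        unfolding br using A b k1 3 by (simp add: m_assoc)
      also have "\<dots> = s b \<otimes> wp u"
        unfolding Ab u' up' using A b k1 3 by (simp add: m_assoc)
      finally show ?thesis using slide[of b] sub branch i by auto
    next
      case 4
      show ?thesis
      proof (rule move)
        show "[i..<Suc l] \<in> chain i" by (rule chain_intros) (use i in auto)
        show "set [i..<Suc l] \<subseteq> I" using sub by auto
        show "wp u \<otimes> s k = wp [i..<Suc l]" unfolding u' using 4 up b by simp
      qed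
    next
      \<comment> \<open>The second end node of type D completes the tail: this is the return word
        with nothing yet on the way back.\<close>
      case 5
      then have N: "N = Suc (Suc l)" using branch k1 l_bounds by linarith
      have t: "tail = [Suc l, Suc (Suc l)]" using N by simp
      have "m b k = 2" using labels[of b k] labels[of k b] matrix_sym[of b k] 5 branch k1 b
        by (cases "b < k") auto
      then have bk: "s b \<otimes> s k = s k \<otimes> s b" using b k1 by (intro gens_commute) auto
      have "{b, k} = {Suc l, Suc (Suc l)}" using 5 branch k1 N by auto
      then have "s b \<otimes> s k = wp tail" and sub': "{Suc l, Suc (Suc l)} \<subseteq> I"
        using bk b k1 sub k unfolding t by (auto simp: doubleton_eq_iff)
      then have "wp u \<otimes> s k = wp ([i..<Suc l] @ tail @ rev [Suc l..<Suc l])"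
        unfolding u' using up b k1 up_set[of "Suc l"] tail_set
        by (simp add: wp_append m_assoc del: upt_Suc)
      moreover have "[i..<Suc l] @ tail @ rev [Suc l..<Suc l] \<in> chain i"
        by (rule chain_intros) (use N i in auto)
      moreover have "set ([i..<Suc l] @ tail @ rev [Suc l..<Suc l]) \<subseteq> I"
        using sub sub' t by auto
      ultimately show ?thesis by (intro move)
    qed
  next
    case return
    let ?D = "wp (rev [q..<Suc l])"
    have sub: "{i..N} \<subseteq> I"
    proof
      fix x assume "x \<in> {i..N}"
      then have "x \<in> set u" using return by auto
      then show "x \<in> I" using u by auto
    qed
    have D: "?D \<in> carrier W" using down_set return by (intro wp_closed) auto
    have t: "wp tail \<in> carrier W" using tail_set by (intro wp_closed)
    have u': "wp u = ?up \<otimes> (wp tail \<otimes> ?D)"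
      unfolding return(1) using up_set[of "Suc l"] tail_set down_set[of q] return
      by (simp add: wp_append del: upt_Suc)
    have in_chain: "[i..<Suc l] @ tail @ rev [p..<Suc l] \<in> chain i"
      "set ([i..<Suc l] @ tail @ rev [p..<Suc l]) \<subseteq> I"
      "wp ([i..<Suc l] @ tail @ rev [p..<Suc l]) = ?up \<otimes> (wp tail \<otimes> wp (rev [p..<Suc l]))"
      if p: "i \<le> p" "p \<le> Suc l" for p
    proof -
      show "[i..<Suc l] @ tail @ rev [p..<Suc l] \<in> chain i"
        by (rule chain_intros) (use p return in auto)
      show "set ([i..<Suc l] @ tail @ rev [p..<Suc l]) \<subseteq> I"
        using sub p l_bounds by auto
      show "wp ([i..<Suc l] @ tail @ rev [p..<Suc l]) = ?up \<otimes> (wp tail \<otimes> wp (rev [p..<Suc l]))"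
        using up_set[of "Suc l"] tail_set down_set[of p] p
        by (simp add: wp_append del: upt_Suc)
    qed
    have move': ?G if "i \<le> p" "p \<le> Suc l"
      "wp u \<otimes> s k = ?up \<otimes> (wp tail \<otimes> wp (rev [p..<Suc l]))" for p
      using move[OF in_chain(1,2)[OF that(1,2)]] in_chain(3)[OF that(1,2)] that(3) by (simp only:)
    have cons: "wp (rev [p..<Suc l]) = wp (rev [Suc p..<Suc l]) \<otimes> s p" if "i \<le> p" "p \<le> l" for p
    proof -
      have "rev [p..<Suc l] = rev [Suc p..<Suc l] @ [p]"
        using that by (simp add: upt_conv_Cons del: upt_Suc)
      then show ?thesis using that down_set[of "Suc p"] i1 l_bounds by (simp add: wp_append del: upt_Suc)
    qed
    have slide': ?G if "j \<in> I" "j \<noteq> i" "j' \<in> gens" "?up \<otimes> s j' = s j \<otimes> ?up"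
      "(wp tail \<otimes> ?D) \<otimes> s k = s j' \<otimes> (wp tail \<otimes> ?D)" for j j'
    proof (rule slide[of j])
      have j: "j \<in> gens" using that I by auto
      have "wp u \<otimes> s k = ?up \<otimes> (s j' \<otimes> (wp tail \<otimes> ?D))"
        unfolding u' using that(5) up t D k1 by (simp add: m_assoc del: upt_Suc)
      also have "\<dots> = (?up \<otimes> s j') \<otimes> (wp tail \<otimes> ?D)"
        using that(3) up t D by (simp add: m_assoc del: upt_Suc)
      also have "\<dots> = s j \<otimes> ?up \<otimes> (wp tail \<otimes> ?D)"
        unfolding that(4) ..
      finally show "wp u \<otimes> s k = s j \<otimes> wp u" unfolding u' using up t D j by (simp add: m_assoc del: upt_Suc)
    qed (use that in auto)
    consider "l < k" "q = Suc l" "N = Suc l" | "l < k" "q = Suc l" "N = Suc (Suc l)"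
      | "l < k" "q \<le> l" | "k = q" "k \<le> l" | "Suc k = q" | "Suc k < q" | "q < k" "k \<le> l"
      using return l_bounds by linarith
    then show ?thesis
    proof cases
      case 1
      then have "k = N" using k1 by simp
      show ?thesis
      proof (rule move)
        show "[i..<Suc l] \<in> chain i" by (rule chain_intros) (use i in auto)
        show "set [i..<Suc l] \<subseteq> I" using sub 1 by auto
        show "wp u \<otimes> s k = wp [i..<Suc l]"
          unfolding u' using 1 \<open>k = N\<close> up k1 by (simp add: m_assoc)
      qed
    next
      case 2
      define b where "b = (if k = N then Suc l else N)"
      have b: "b \<in> gens" "b \<in> I" "l < b" "b \<le> N" using 2 sub i k1 by (auto simp: b_def)
      have "m (Suc l) N = 2" using labels[of "Suc l" N] 2 by auto
      then have "s (Suc l) \<otimes> s N = s N \<otimes> s (Suc l)" using 2 k1 by (intro gens_commute) auto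
      moreover have "wp tail = s (Suc l) \<otimes> s N" using 2 k1 by simp
      moreover have "k = N \<or> k = Suc l" using 2 k1 by auto
      ultimately have "wp tail = s b \<otimes> s k" using 2 by (auto simp: b_def)
      then have "wp u \<otimes> s k = ?up \<otimes> s b"
        unfolding u' using 2 up k1 b by (simp add: m_assoc del: upt_Suc)
      also have "\<dots> = wp ([i..<Suc l] @ [b])"
        using up_set[of "Suc l"] b by (simp add: wp_append del: upt_Suc)
      finally have "wp u \<otimes> s k = wp ([i..<Suc l] @ [b])" .
      moreover have "set ([i..<Suc l] @ [b]) \<subseteq> I" using sub b l_bounds by auto
      ultimately show ?thesis using chain_intros(2)[OF b(3,4)] by (intro move)
    next
      \<comment> \<open>On the way back, \<open>s k\<close> commutes with all letters below
        \<open>l\<close>; \<open>tail_conjugate\<close> then turns it into an end node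
        \<open>s j\<close>, which commutes with the path below \<open>l\<close>.\<close>
      case 3
      let ?E = "wp (rev [q..<l])"
      have Es: "set (rev [q..<l]) \<subseteq> gens" using return i1 l_bounds by auto
      then have E: "?E \<in> carrier W" by (rule wp_closed)
      have lg: "l \<in> gens" using l_bounds by auto
      have D': "?D = s l \<otimes> ?E" using 3 E by simp
      have Ek: "?E \<otimes> s k = s k \<otimes> ?E"
        using k1 return i1 3 l_bounds by (intro commute_word matrix_nonadjacent) auto
      obtain j where j: "l < j" "j \<le> N"
        "s l \<otimes> wp tail \<otimes> s l \<otimes> s k = s j \<otimes> (s l \<otimes> wp tail \<otimes> s l)"
        using tail_conjugate[of k] 3 k1 by auto
      have jg: "j \<in> gens" using j by auto
      let ?A = "wp [i..<l]"
      have A: "?A \<in> carrier W" using up_set[of l] by (intro wp_closed) auto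
      have up': "?up = ?A \<otimes> s l" using up_set[of l] i lg by (simp add: wp_append)
      have Aj: "?A \<otimes> s j = s j \<otimes> ?A"
        using j i1 by (intro commute_word matrix_nonadjacent) auto
      have "wp u \<otimes> s k = ?A \<otimes> (s l \<otimes> wp tail \<otimes> s l) \<otimes> (?E \<otimes> s k)"
        unfolding u' up' D' using A lg t E k1 by (simp add: m_assoc del: upt_Suc)
      also have "\<dots> = ?A \<otimes> (s l \<otimes> wp tail \<otimes> s l \<otimes> s k) \<otimes> ?E"
        unfolding Ek using A lg t E k1 by (simp add: m_assoc del: upt_Suc)
      also have "\<dots> = (?A \<otimes> s j) \<otimes> (s l \<otimes> wp tail \<otimes> s l) \<otimes> ?E"
        unfolding j(3) using A lg t E jg by (simp add: m_assoc del: upt_Suc)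
      also have "\<dots> = s j \<otimes> wp u"
        unfolding Aj u' up' D' using A lg t E jg by (simp add: m_assoc del: upt_Suc)
      finally have "wp u \<otimes> s k = s j \<otimes> wp u" .
      moreover have "j \<in> I" using sub j i by auto
      ultimately show ?thesis using slide[of j] j i by auto
    next
      case 4
      have c: "?D = wp (rev [Suc q..<Suc l]) \<otimes> s q" using cons 4 return by simp
      have "wp (rev [Suc q..<Suc l]) \<in> carrier W" using down_set[of "Suc q"] return by (intro wp_closed) auto
      then have "wp u \<otimes> s k = ?up \<otimes> (wp tail \<otimes> wp (rev [Suc q..<Suc l]))"
        unfolding u' c using 4 up t k1 by (simp add: m_assoc del: upt_Suc)
      then show ?thesis using move'[of "Suc q"] 4 return by simp
    next
      case 5
      have "wp u \<otimes> s k = ?up \<otimes> (wp tail \<otimes> wp (rev [k..<Suc l]))"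
        unfolding u' using cons[of k] 5 up t D k1 return by (simp add: m_assoc del: upt_Suc)
      then show ?thesis using move'[of k] 5 k1 return by simp
    next
      case 6
      have Dk: "?D \<otimes> s k = s k \<otimes> ?D"
        using k1 6 return l_bounds by (intro commute_word matrix_nonadjacent) auto
      have tk: "wp tail \<otimes> s k = s k \<otimes> wp tail"
        using k1 6 return i1 by (intro tail_commute) auto
      have "(wp tail \<otimes> ?D) \<otimes> s k = (wp tail \<otimes> s k) \<otimes> ?D"
        using t D k1 Dk by (simp add: m_assoc del: upt_Suc)
      also have "\<dots> = s k \<otimes> (wp tail \<otimes> ?D)"
        unfolding tk using t D k1 by (simp add: m_assoc del: upt_Suc)
      finally have "(wp tail \<otimes> ?D) \<otimes> s k = s k \<otimes> (wp tail \<otimes> ?D)" .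
      moreover have "?up \<otimes> s k = s (Suc k) \<otimes> ?up"
        using i1 k1 6 return by (intro up_shift) auto
      moreover have "Suc k \<in> I" using sub 6 k1 return by auto
      ultimately show ?thesis using k1 by (intro slide'[of "Suc k" k]) auto
    next
      \<comment> \<open>The way back lowers the index to \<open>k - 1\<close>, the tail leaves it
        alone, and the way up raises it again, so \<open>s k\<close> itself appears on the
        left.\<close>
      case 7
      have Dk: "?D \<otimes> s k = s (k - 1) \<otimes> ?D"
        using k1 7 return i1 by (intro down_shift) auto
      have k': "k - 1 \<in> gens" using 7 return i1 k1 by auto
      have tk: "wp tail \<otimes> s (k - 1) = s (k - 1) \<otimes> wp tail"
        using k1 7 return i1 by (intro tail_commute) auto
      have "(wp tail \<otimes> ?D) \<otimes> s k = (wp tail \<otimes> s (k - 1)) \<otimes> ?D"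
        using t D k1 Dk k' by (simp add: m_assoc del: upt_Suc)
      also have "\<dots> = s (k - 1) \<otimes> (wp tail \<otimes> ?D)"
        unfolding tk using t D k' by (simp add: m_assoc del: upt_Suc)
      finally have "(wp tail \<otimes> ?D) \<otimes> s k = s (k - 1) \<otimes> (wp tail \<otimes> ?D)" .
      moreover have "?up \<otimes> s (k - 1) = s k \<otimes> ?up"
        using up_shift[of i "k - 1" l] i1 7 return by auto
      ultimately show ?thesis
        using 7 return k k' by (intro slide'[of k "k - 1"]) auto
    qed
  qed
qed

text \<open>The number of times a chain word may visit a node. It reappears as the bound on the
  inversions made by a generator, since types B and D count each root
  \<open>e_i \<plusminus> e_j\<close> as two pairs.\<close>

definition growth :: nat where "growth = (if l < N then 2 else 1)"

lemma chain_length: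
  assumes I: "I \<subseteq> gens" and u: "u \<in> chain i" "set u \<subseteq> I"
  shows "length u \<le> growth * card I"
proof -
  have fin: "finite I" using I finite_subset by blast
  consider (path) q where "u = [i..<q]"
    | (branch) b where "u = [i..<Suc l] @ [b]" "l < b" "b \<le> N"
    | (return) q where "u = [i..<Suc l] @ tail @ rev [q..<Suc l]" "i \<le> q" "q \<le> Suc l" "l < N"
    using u(1) by (auto simp: chain_def simp del: upt_Suc split: if_splits)
  then show ?thesis
  proof cases
    case path
    have "card {i..<q} \<le> card I" using path u fin by (intro card_mono) auto
    then show ?thesis using path by (auto simp: growth_def)
  next
    case branch
    have "distinct u" using branch by auto
    then have "length u \<le> card I" using u fin distinct_card[of u] card_mono[of I "set u"] by simp
    then show ?thesis by (auto simp: growth_def)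
  next
    case return
    have "{i..N} \<subseteq> I"
    proof
      fix x assume "x \<in> {i..N}"
      then have "x \<in> set u" using return by auto
      then show "x \<in> I" using u by auto
    qed
    then have "card {i..N} \<le> card I" using fin by (rule card_mono[rotated])
    moreover have "length u \<le> 2 * card {i..N}" using return by (auto simp del: upt_Suc)
    ultimately show ?thesis using return by (auto simp: growth_def)
  qed
qed

text \<open>Splitting off the least node costs at most \<open>growth * card I\<close> in length, and
  over the successive nodes these costs add up to a triangular number.\<close>

lemma parabolic_length_bound:
  assumes "I \<subseteq> gens" "w \<in> parabolic I"
  shows "2 * cox_length w \<le> growth * (card I * (card I + 1))"
  using assms
proof (induction "card I" arbitrary: I w)
  case 0
  then have "I = {}" by (metis card_0_eq finite_atLeastAtMost finite_subset)
  then have "w = \<one>" using word_in_parabolic[OF 0(2,3)] by auto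
  then show ?case using cox_length_le[of "[]"] by simp
next
  case (Suc x)
  have fin: "finite I" using Suc.prems finite_subset by blast
  define i where "i = Min I"
  have "I \<noteq> {}" using Suc.hyps(2) by auto
  then have i: "i \<in> I" "\<And>x. x \<in> I \<Longrightarrow> i \<le> x" using fin by (auto simp: i_def)
  then have ig: "i \<in> gens" using Suc.prems by auto
  have card: "card (I - {i}) = x" using Suc.hyps(2) i fin by simp
  have L: "cox_length h \<le> growth * (x * (x + 1)) div 2" if "h \<in> parabolic (I - {i})" for h
    using Suc.hyps(1)[of "I - {i}" h] that card Suc.prems by force
  have "\<exists>C \<subseteq> carrier W. \<one> \<in> C \<and> (\<forall>c\<in>C. cox_length c \<le> growth * card I) \<and>
      (\<forall>c\<in>C. \<forall>k\<in>I. c \<otimes> s k \<in> C \<or> (\<exists>j\<in>I - {i}. c \<otimes> s k = s j \<otimes> c))"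
  proof (cases "i \<le> l")
    case True
    let ?C = "wp ` {v \<in> chain i. set v \<subseteq> I}"
    have "wp [i..<i] \<in> ?C" using True chain_intros(1)[of i i] by (intro imageI) simp
    moreover have "?C \<subseteq> carrier W" using Suc.prems by (auto intro!: wp_closed)
    moreover have "cox_length c \<le> growth * card I" if c: "c \<in> ?C" for c
    proof -
      obtain v where v: "v \<in> chain i" "set v \<subseteq> I" "c = wp v" using c by auto
      then have "cox_length c \<le> length v"
        using cox_length_le[of v] Suc.prems(1) by (meson order_trans)
      also have "\<dots> \<le> growth * card I" using chain_length[OF Suc.prems(1) v(1,2)] .
      finally show ?thesis .
    qed
    ultimately show ?thesis
      using chain_closed[OF Suc.prems(1) i True] by (intro exI[of _ ?C]) auto
  next
    \<comment> \<open>Beyond the path only pairwise commuting end nodes remain, so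
      \<open>\<one>\<close> and \<open>s i\<close> serve as the chain.\<close>
    case False
    have "cox_length c \<le> growth * card I" if c: "c \<in> {\<one>, s i}" for c
    proof -
      have "cox_length c \<le> 1"
        using c cox_length_le[of "[i]"] cox_length_le[of "[]"] ig by auto
      also have "1 \<le> growth * card I" using Suc.hyps(2) by (auto simp: growth_def)
      finally show ?thesis .
    qed
    moreover have "c \<otimes> s k \<in> {\<one>, s i} \<or> (\<exists>j\<in>I - {i}. c \<otimes> s k = s j \<otimes> c)"
      if "c \<in> {\<one>, s i}" "k \<in> I" for c k
    proof (cases "k = i")
      case True
      then show ?thesis using that ig by auto
    next
      case k: False
      have kg: "k \<in> gens" using that Suc.prems by auto
      have "m i k = 2" using k i(2)[OF that(2)] kg ig False by (intro matrix_nonadjacent) auto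
      then have "s i \<otimes> s k = s k \<otimes> s i" using kg ig by (intro gens_commute) auto
      then have "c \<otimes> s k = s k \<otimes> c" using that kg by auto
      then show ?thesis using k that by blast
    qed
    ultimately show ?thesis using ig by (intro exI[of _ "{\<one>, s i}"]) auto
  qed
  then obtain C where C: "C \<subseteq> carrier W" "\<one> \<in> C" "\<And>c. c \<in> C \<Longrightarrow> cox_length c \<le> growth * card I"
    "\<And>c k. c \<in> C \<Longrightarrow> k \<in> I \<Longrightarrow> c \<otimes> s k \<in> C \<or> (\<exists>j\<in>I - {i}. c \<otimes> s k = s j \<otimes> c)"
    by blast
  have "cox_length w \<le> growth * (x * (x + 1)) div 2 + growth * card I"
    using parabolic_chain_bound[OF Suc.prems(1) C(2,1,4,3) L Suc.prems(2)] by blast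
  then have "2 * cox_length w \<le> growth * (x * (x + 1)) + 2 * (growth * card I)" by linarith
  also have "\<dots> = growth * (card I * (card I + 1))"
    unfolding Suc.hyps(2)[symmetric] by (simp add: algebra_simps)
  finally show ?case .
qed

text \<open>Lengths are bounded on all of \<open>parabolic gens\<close>, and only finitely many
  words are that short.\<close>

lemma finite_group: "finite (carrier W)"
proof -
  have "2 * cox_length w \<le> growth * (N * (N + 1))" if "w \<in> carrier W" for w
    using parabolic_length_bound[of gens w] that parabolic_gens by simp
  then have "carrier W \<subseteq> {w \<in> carrier W. cox_length w \<le> growth * (N * (N + 1))}" by force
  then show ?thesis using finite_bounded_length finite_subset by blast
qed

lemma proper_length_bound:
  assumes "proper w"
  shows "2 * cox_length w \<le> 2 * N +
    growth * (card (left_descents w) * (card (left_descents w) + 1))"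
proof -
  let ?d = "card (left_descents w)"
  have "maxw0 ?d \<le> growth * (?d * (?d + 1)) div 2"
  proof (rule maxw0_le[OF card_descents_le])
    fix I w' assume "I \<subseteq> gens" "card I = ?d" "w' \<in> parabolic I"
    then show "cox_length w' \<le> growth * (?d * (?d + 1)) div 2"
      using parabolic_length_bound[of I w'] by simp
  qed
  then show ?thesis using assms unfolding proper_def by linarith
qed

text \<open>Adjacent nodes have indices at most 2 apart, the distance 2 arising at the fork of type
  D; hence at most 5 partners for each node, itself included.\<close>

lemma noncommuting_pairs:
  "card {(j, k). j \<in> gens \<and> k \<in> gens \<and> (j = k \<or> m j k \<noteq> 2)} \<le> 5 * N"
proof -
  let ?Q = "{(j, k). j \<in> gens \<and> k \<in> gens \<and> (j = k \<or> m j k \<noteq> 2)}"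
  have "?Q \<subseteq> (SIGMA j:gens. {j - 2..j + 2})"
  proof
    fix x assume "x \<in> ?Q"
    then obtain j k where x: "x = (j, k)" "j \<in> gens" "k \<in> gens" "j = k \<or> m j k \<noteq> 2" by auto
    then have "k \<le> j + 2 \<and> j \<le> k + 2"
      using labels[of j k] labels[of k j] matrix_sym[of j k] l_bounds
      by (cases j k rule: linorder_cases) (auto split: if_splits)
    then show "x \<in> (SIGMA j:gens. {j - 2..j + 2})" using x by auto
  qed
  then have "card ?Q \<le> card (SIGMA j:gens. {j - 2..j + 2})"
    by (intro card_mono) auto
  also have "\<dots> = (\<Sum>j\<in>gens. card {j - 2..j + 2})" by (intro card_SigmaI) auto
  also have "\<dots> \<le> (\<Sum>j\<in>gens. 5)" by (intro sum_mono) auto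
  finally show ?thesis by simp
qed

end

section \<open>Action by signed permutations\<close>

text \<open>The signed permutation exchanging \<open>a\<close> with \<open>b\<close> and \<open>-a\<close> with \<open>-b\<close>, where the signed points
  are shifted so that \<open>x \<mapsto> M - x\<close> is the sign change and the order is the usual one.\<close>

definition signed_swap :: "int \<Rightarrow> int \<times> int \<Rightarrow> int \<Rightarrow> int" where
  "signed_swap M p x =
     (if x = fst p then snd p else if x = snd p then fst p
      else if x = M - fst p then M - snd p else if x = M - snd p then M - fst p else x)"

lemma signed_swap_involution:
  "odd M \<Longrightarrow> a \<noteq> b \<Longrightarrow> signed_swap M (a, b) (signed_swap M (a, b) x) = x"
  unfolding signed_swap_def by simp presburger

lemma signed_swap_minus:
  "odd M \<Longrightarrow> a \<noteq> b \<Longrightarrow> signed_swap M (a, b) (M - x) = M - signed_swap M (a, b) x"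
  unfolding signed_swap_def by simp presburger

lemma signed_swap_sym: "signed_swap M (b, a) = signed_swap M (a, b)"
  unfolding signed_swap_def by (rule ext) simp

lemma signed_swap_bar: "odd M \<Longrightarrow> a \<noteq> b \<Longrightarrow> signed_swap M (M - a, M - b) = signed_swap M (a, b)"
  unfolding signed_swap_def by (rule ext, simp) presburger

text \<open>A conjugate of a signed swap is determined by the images of two points, which turns the
  Coxeter relations into comparisons of pairs.\<close>

lemma signed_swap_conj:
  assumes "inj f" "\<And>x. f (M - x) = M - f x"
  shows "f (signed_swap M (a, b) x) = signed_swap M (f a, f b) (f x)"
  using assms inj_eq[OF assms(1), of x a] inj_eq[OF assms(1), of x b]
    inj_eq[OF assms(1), of x "M - a"] inj_eq[OF assms(1), of x "M - b"]
  by (auto simp: signed_swap_def)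

definition path_swap :: "int \<Rightarrow> int \<Rightarrow> int \<Rightarrow> int" where
  "path_swap M k x = (if x = k then k + 1 else if x = k + 1 then k
    else if x = M - k then M - k - 1 else if x = M - k - 1 then M - k else x)"

lemma path_swap_inversion:
  "a < b \<Longrightarrow> a + b \<noteq> M \<Longrightarrow> path_swap M k b < path_swap M k a \<Longrightarrow>
   (a = k \<and> b = k + 1) \<or> (a = M - k - 1 \<and> b = M - k)"
  unfolding path_swap_def by (simp split: if_splits; linarith)

context branched_path
begin

text \<open>Type A permutes \<open>N + 1\<close> points in the lower half; the mirror half is
  carried along so that one formula serves all three types, but \<open>top_point\<close> keeps it
  out of the count.\<close>

definition coords :: nat where "coords = (if l < N then N else Suc N)"

definition M :: int where "M = 2 * int coords + 1"

definition top_point :: int where "top_point = (if l < N then 2 * int coords else int coords)"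

text \<open>In types B and D the point \<open>N + 1\<close> stands for \<open>-N\<close>. The fork
  generator is thus the reflection in \<open>e_{N-1} + e_N\<close>, and the last generator of type
  B, with pair \<open>(N, N + 1)\<close>, is a sign change.\<close>

definition gen_pair :: "nat \<Rightarrow> int \<times> int" where
  "gen_pair k = (if k = N \<and> N = l + 2 then (int N - 1, int N + 1) else (int k, int k + 1))"

definition \<rho> :: "nat \<Rightarrow> int \<Rightarrow> int" where "\<rho> k = signed_swap M (gen_pair k)"

text \<open>In types \<open>B\<close> and \<open>D\<close> each root \<open>e\<^sub>i \<plusminus> e\<^sub>j\<close> appears as the two pairs \<open>(a, b)\<close> and
  \<open>(M - b, M - a)\<close>, and the short roots of type \<open>B\<close> (pairs with \<open>a + b = M\<close>) are left out: they are
  too few to matter. A generator creates at most \<open>growth\<close> inversions.\<close>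

definition root_pairs :: "(int \<times> int) set" where
  "root_pairs = {(a, b). 1 \<le> a \<and> a < b \<and> b \<le> top_point \<and> a + b \<noteq> M}"

text \<open>Pairs sharing a coordinate up to sign: off this set the swap of one pair fixes both
  entries of the other. Its size is at most of order \<open>points^3\<close>.\<close>

definition linked_pairs :: "((int \<times> int) \<times> int \<times> int) set" where
  "linked_pairs = {((a, b), (c, d)). (a, b) \<in> root_pairs \<and> (c, d) \<in> root_pairs \<and>
     (c \<in> {a, b, M - a, M - b} \<or> d \<in> {a, b, M - a, M - b})}"

section \<open>The Coxeter relations for signed permutations\<close>

lemma odd_M: "odd M" by (simp add: M_def)

lemma rho_involution [simp]: "\<rho> k (\<rho> k x) = x"
  unfolding \<rho>_def gen_pair_def using odd_M by (auto intro: signed_swap_involution)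

lemma rho_inj: "inj (\<rho> k)"
  by (metis injI rho_involution)

lemma rho_minus: "\<rho> k (M - x) = M - \<rho> k x"
  unfolding \<rho>_def gen_pair_def using odd_M by (auto intro: signed_swap_minus)

lemma rho_conj: "\<rho> k (signed_swap M (a, b) x) = signed_swap M (\<rho> k a, \<rho> k b) (\<rho> k x)"
  by (rule signed_swap_conj[OF rho_inj rho_minus])

lemma rho_commute:
  assumes "signed_swap M (\<rho> i (fst (gen_pair j)), \<rho> i (snd (gen_pair j))) = \<rho> j"
  shows "\<rho> i (\<rho> j x) = \<rho> j (\<rho> i x)"
  using rho_conj[of i "fst (gen_pair j)" "snd (gen_pair j)" x] assms by (simp add: \<rho>_def)

lemma rho_conj_gen:
  "\<rho> i (\<rho> j (\<rho> i x)) = signed_swap M (\<rho> i (fst (gen_pair j)), \<rho> i (snd (gen_pair j))) x"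
proof -
  have "signed_swap M (fst (gen_pair j), snd (gen_pair j)) = \<rho> j" by (simp add: \<rho>_def)
  then show ?thesis
    using rho_conj[of i "fst (gen_pair j)" "snd (gen_pair j)" "\<rho> i x"]
    by (simp only: rho_involution)
qed

text \<open>Both sides are reflections, as conjugates of \<open>\<rho> j\<close> and of
  \<open>\<rho> i\<close>, and agree once their defining pairs do.\<close>

lemma rho_braid:
  assumes "(\<rho> i (fst (gen_pair j)), \<rho> i (snd (gen_pair j))) =
    (\<rho> j (fst (gen_pair i)), \<rho> j (snd (gen_pair i)))"
  shows "\<rho> i (\<rho> j (\<rho> i x)) = \<rho> j (\<rho> i (\<rho> j x))"
  by (simp only: rho_conj_gen assms)

lemma rho_path:
  assumes "k \<noteq> N \<or> N \<noteq> l + 2"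
  shows "\<rho> k x = path_swap M (int k) x"
  using assms by (auto simp: \<rho>_def signed_swap_def gen_pair_def path_swap_def)

lemma rho_fork:
  assumes "N = l + 2"
  shows "\<rho> N x = (if x = int N - 1 then int N + 1 else if x = int N + 1 then int N - 1
    else if x = int N + 2 then int N else if x = int N then int N + 2 else x)"
  unfolding \<rho>_def signed_swap_def gen_pair_def M_def coords_def using assms by auto

lemmas rho_unfold = \<rho>_def signed_swap_def gen_pair_def M_def coords_def

lemma rho_relations:
  assumes "1 \<le> i" "i < j" "j \<le> N"
  shows "m i j = 2 \<Longrightarrow> \<rho> i (\<rho> j x) = \<rho> j (\<rho> i x)"
    and "m i j = 3 \<Longrightarrow> \<rho> i (\<rho> j (\<rho> i x)) = \<rho> j (\<rho> i (\<rho> j x))"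
    and "m i j = 4 \<Longrightarrow> \<rho> i (\<rho> j (\<rho> i (\<rho> j x))) = \<rho> j (\<rho> i (\<rho> j (\<rho> i x)))"
proof -
  show "\<rho> i (\<rho> j x) = \<rho> j (\<rho> i x)" if "m i j = 2"
  proof (cases "l < i")
    \<comment> \<open>The two end nodes of type D: \<open>\<rho> i\<close> carries the pair of
      \<open>j\<close> to its mirror image in reversed order, which defines the same signed
      swap.\<close>
    case True
    then have "N = l + 2" "i = Suc l" "j = N" using assms l_bounds by auto
    then have "\<rho> i (fst (gen_pair j)) = M - snd (gen_pair j)"
      "\<rho> i (snd (gen_pair j)) = M - fst (gen_pair j)" "fst (gen_pair j) \<noteq> snd (gen_pair j)"
      using l_bounds unfolding rho_unfold by auto
    then show ?thesis
      using signed_swap_bar[OF odd_M] signed_swap_sym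
      by (intro rho_commute) (metis prod.collapse \<rho>_def)
  next
    case False
    then have "\<rho> i (fst (gen_pair j)) = fst (gen_pair j)"
      "\<rho> i (snd (gen_pair j)) = snd (gen_pair j)"
      using labels[of i j] that assms l_bounds unfolding rho_unfold by (auto split: if_splits)
    then show ?thesis by (intro rho_commute) (simp add: \<rho>_def)
  qed
  show "\<rho> i (\<rho> j (\<rho> i x)) = \<rho> j (\<rho> i (\<rho> j x))" if "m i j = 3"
    by (rule rho_braid) (use labels[of i j] that assms l_bounds in \<open>(unfold rho_unfold, auto split: if_splits)\<close>)
  show "\<rho> i (\<rho> j (\<rho> i (\<rho> j x))) = \<rho> j (\<rho> i (\<rho> j (\<rho> i x)))" if "m i j = 4"
  proof -
    have ij: "i = l" "j = N" "N = l + 1"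
      using labels[of i j] that assms l_bounds by (auto split: if_splits)
    \<comment> \<open>The conjugate of \<open>\<rho> j\<close> by \<open>\<rho> i\<close> is the
      sign change of the coordinate \<open>l\<close>; \<open>\<rho> j\<close> fixes both of its
      points and therefore commutes with it.\<close>
    let ?p = "(\<rho> i (fst (gen_pair j)), \<rho> i (snd (gen_pair j)))"
    have h: "\<rho> i (\<rho> j (\<rho> i y)) = signed_swap M ?p y" for y by (rule rho_conj_gen)
    have "\<rho> j (fst ?p) = fst ?p" "\<rho> j (snd ?p) = snd ?p"
      using ij l_bounds unfolding rho_unfold by auto
    then show ?thesis using rho_conj[of j "fst ?p" "snd ?p" x] h by simp
  qed
qed

lemma rho_relator:
  assumes "i \<in> gens" "j \<in> gens"
  shows "foldr \<rho> (concat (replicate (m i j) [i, j])) = id"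
proof (rule ext)
  fix x
  have "i = j \<or> m i j \<in> {2, 3, 4}"
    using labels[of i j] labels[of j i] matrix_sym[OF assms] assms
    by (cases i j rule: linorder_cases) auto
  then consider "i = j" | "i \<noteq> j" "m i j = 2" | "i \<noteq> j" "m i j = 3" | "i \<noteq> j" "m i j = 4"
    by auto
  then show "foldr \<rho> (concat (replicate (m i j) [i, j])) x = id x"
  proof cases
    case 1
    then show ?thesis using matrix_diag assms by simp
  next
    case 2
    then have "\<rho> i (\<rho> j y) = \<rho> j (\<rho> i y)" for y
      using rho_relations(1)[of i j] rho_relations(1)[of j i, symmetric] matrix_sym[OF assms] assms
      by (cases i j rule: linorder_cases) auto
    then have "\<rho> i (\<rho> j (\<rho> i (\<rho> j x))) = \<rho> i (\<rho> i (\<rho> j (\<rho> j x)))" by metis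
    then show ?thesis using 2 by (simp add: numeral_2_eq_2)
  next
    case 3
    then have "\<rho> i (\<rho> j (\<rho> i y)) = \<rho> j (\<rho> i (\<rho> j y))" for y
      using rho_relations(2)[of i j] rho_relations(2)[of j i, symmetric] matrix_sym[OF assms] assms
      by (cases i j rule: linorder_cases) auto
    then have "\<rho> i (\<rho> j (\<rho> i (\<rho> j (\<rho> i (\<rho> j x))))) = \<rho> j (\<rho> i (\<rho> j (\<rho> j (\<rho> i (\<rho> j x)))))"
      by metis
    then show ?thesis using 3 by (simp add: numeral_3_eq_3)
  next
    case 4
    then have "\<rho> i (\<rho> j (\<rho> i (\<rho> j y))) = \<rho> j (\<rho> i (\<rho> j (\<rho> i y)))" for y
      using rho_relations(3)[of i j] rho_relations(3)[of j i, symmetric] matrix_sym[OF assms] assms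
      by (cases i j rule: linorder_cases) auto
    then have "\<rho> i (\<rho> j (\<rho> i (\<rho> j (\<rho> i (\<rho> j (\<rho> i (\<rho> j x))))))) =
        \<rho> j (\<rho> i (\<rho> j (\<rho> i (\<rho> i (\<rho> j (\<rho> i (\<rho> j x)))))))"
      by metis
    then show ?thesis using 4 by (simp add: eval_nat_numeral)
  qed
qed

lemma rho_root_pairs:
  assumes "k \<in> gens" "(a, b) \<in> root_pairs"
  shows "(\<rho> k a, \<rho> k b) \<in> root_pairs \<or> (\<rho> k b, \<rho> k a) \<in> root_pairs"
proof -
  have range: "1 \<le> \<rho> k x \<and> \<rho> k x \<le> top_point" if "1 \<le> x" "x \<le> top_point" for x
  proof (cases "k = N \<and> N = l + 2")
    case True
    then have k: "k = N" and N: "N = l + 2" by auto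
    have "top_point = 2 * int N" unfolding top_point_def coords_def using N by auto
    then show ?thesis unfolding k rho_fork[OF N] using that N by auto
  next
    case False
    have "l < N \<and> top_point = 2 * int N \<and> M = 2 * int N + 1 \<or> top_point = int N + 1 \<and> M = 2 * int N + 3"
      by (auto simp: top_point_def coords_def M_def)
    moreover have "1 \<le> int k" "int k \<le> int N" using assms(1) by auto
    moreover have "\<rho> k x = path_swap M (int k) x"
      using False by (intro rho_path) auto
    ultimately show ?thesis using that by (auto simp: path_swap_def split: if_splits)
  qed
  have "\<rho> k a + \<rho> k b \<noteq> M"
  proof
    assume "\<rho> k a + \<rho> k b = M"
    then have "\<rho> k a = \<rho> k (M - b)" by (simp add: rho_minus)
    then have "a = M - b" using rho_inj by (auto dest: injD)
    then show False using assms by (auto simp: root_pairs_def)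
  qed
  moreover have "\<rho> k a \<noteq> \<rho> k b" using rho_inj assms by (auto simp: root_pairs_def dest: injD)
  ultimately show ?thesis using range[of a] range[of b] assms by (auto simp: root_pairs_def)
qed

lemma finite_root_pairs: "finite root_pairs"
  by (rule finite_subset[of _ "{1..top_point} \<times> {1..top_point}"]) (auto simp: root_pairs_def)

text \<open>A generator can invert only its own pair and the mirror image of that pair; in type A
  the mirror image lies above \<open>top_point\<close>.\<close>

lemma rho_inversions:
  assumes "k \<in> gens"
  shows "card {(a, b) \<in> root_pairs. \<rho> k b < \<rho> k a} \<le> growth"
proof (cases "l < N")
  case True
  have "{(a, b) \<in> root_pairs. \<rho> k b < \<rho> k a} \<subseteq>
      {gen_pair k, (M - snd (gen_pair k), M - fst (gen_pair k))}" (is "?L \<subseteq> ?R")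
  proof
    fix p assume "p \<in> ?L"
    then obtain a b where p: "p = (a, b)" and ab: "(a, b) \<in> root_pairs" "\<rho> k b < \<rho> k a" by auto
    have M: "M = 2 * int N + 1" using True by (simp add: M_def coords_def)
    show "p \<in> ?R"
    proof (cases "k = N \<and> N = l + 2")
      case True
      then have k: "k = N" and N: "N = l + 2" by auto
      have "gen_pair k = (int N - 1, int N + 1)" unfolding gen_pair_def using k N by simp
      moreover have "a < b" "a + b \<noteq> 2 * int N + 1" using ab(1) M by (auto simp: root_pairs_def)
      ultimately show ?thesis
        using ab(2) unfolding p k rho_fork[OF N] M by (auto split: if_splits)
    next
      case False
      have "gen_pair k = (int k, int k + 1)" using False by (auto simp: gen_pair_def)
      moreover have "a < b" "a + b \<noteq> M" using ab(1) by (auto simp: root_pairs_def)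
      moreover have "path_swap M (int k) b < path_swap M (int k) a"
        using rho_path[of k a] rho_path[of k b] False ab(2) by auto
      ultimately show ?thesis
        using p path_swap_inversion[of a b M "int k"] by auto
    qed
  qed
  then have "card ?L \<le> card ?R" by (intro card_mono) auto
  also have "\<dots> \<le> 2" by (simp add: card_insert_if)
  finally show ?thesis using True by (simp add: growth_def)
next
  case False
  have "{(a, b) \<in> root_pairs. \<rho> k b < \<rho> k a} \<subseteq> {gen_pair k}"
  proof
    fix p assume "p \<in> {(a, b) \<in> root_pairs. \<rho> k b < \<rho> k a}"
    then obtain a b where p: "p = (a, b)" and ab: "(a, b) \<in> root_pairs" "\<rho> k b < \<rho> k a" by auto
    have N: "N \<noteq> l + 2" using False by auto
    then have "gen_pair k = (int k, int k + 1)" by (auto simp: gen_pair_def)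
    moreover have "a < b" "a + b \<noteq> M" "b < M - int k"
      using ab(1) assms False by (auto simp: root_pairs_def top_point_def coords_def M_def)
    moreover have "path_swap M (int k) b < path_swap M (int k) a"
      using rho_path[of k a] rho_path[of k b] N ab(2) by auto
    ultimately show "p \<in> {gen_pair k}"
      using p path_swap_inversion[of a b M "int k"] by auto
  qed
  then have "card {(a, b) \<in> root_pairs. \<rho> k b < \<rho> k a} \<le> card {gen_pair k}"
    by (intro card_mono) auto
  then show ?thesis using False by (simp add: growth_def)
qed

section \<open>Reflections as products of generators\<close>

definition realized :: "int \<Rightarrow> int \<Rightarrow> bool" where
  "realized a b \<longleftrightarrow> (\<exists>u. set u \<subseteq> gens \<and> foldr \<rho> u = signed_swap M (a, b))"

lemma realized_gen: "k \<in> gens \<Longrightarrow> gen_pair k = (a, b) \<Longrightarrow> realized a b"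
  unfolding realized_def by (intro exI[of _ "[k]"]) (auto simp: \<rho>_def)

lemma realized_conj:
  assumes "realized a b" "k \<in> gens" "\<rho> k a = a'" "\<rho> k b = b'"
  shows "realized a' b'"
proof -
  obtain u where u: "set u \<subseteq> gens" "foldr \<rho> u = signed_swap M (a, b)"
    using assms by (auto simp: realized_def)
  have "foldr \<rho> (k # u @ [k]) = signed_swap M (a', b')"
    using u(2) rho_conj[of k a b] assms by (auto simp: fun_eq_iff)
  then show ?thesis unfolding realized_def using u assms by (intro exI[of _ "k # u @ [k]"]) auto
qed

lemma realized_sym: "realized a b \<Longrightarrow> realized b a"
  using signed_swap_sym by (simp add: realized_def)

lemma realized_bar: "realized a b \<Longrightarrow> a \<noteq> b \<Longrightarrow> realized (M - a) (M - b)"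
  using signed_swap_bar[OF odd_M] by (simp add: realized_def)

lemma realized_positive:
  assumes "1 \<le> a" "a < b" "b \<le> int coords"
  shows "realized a b"
proof -
  have "a + 1 \<le> b" using assms by simp
  then show ?thesis
    using assms(3)
  proof (induction b rule: int_ge_induct)
    case base
    show ?case
      by (rule realized_gen[of "nat a"])
        (use base assms l_bounds in \<open>auto simp: gen_pair_def coords_def split: if_splits\<close>)
  next
    case (step b)
    then have "realized a b" by simp
    then show ?case
      by (rule realized_conj[of _ _ "nat b"])
        (use step assms l_bounds in \<open>(unfold rho_unfold, auto split: if_splits)\<close>)
  qed
qed

text \<open>The entry \<open>a\<close> is first joined to \<open>-N\<close>, the point
  \<open>N + 1\<close>: from the fork generator in type D, by conjugation with the sign change in
  type B. Lowering \<open>b\<close> from \<open>N\<close> by further conjugations reaches the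
  rest.\<close>

lemma realized_negative:
  assumes N: "l < N" and ab: "1 \<le> a" "a < b" "b \<le> int coords"
  shows "realized a (M - b)"
proof -
  have n: "int coords = int N" using N by (simp add: coords_def)
  have top: "realized a (int N + 1)" if a: "1 \<le> a" "a < int N" for a
  proof (cases "N = l + 2")
    case True
    have "a \<le> int N - 1" using a by simp
    then show ?thesis
      using a(1)
    proof (induction a rule: int_le_induct)
      case base
      have "gen_pair N = (int N - 1, int N + 1)" unfolding gen_pair_def using True by simp
      then show ?case using N by (intro realized_gen[of N]) auto
    next
      case (step a)
      then have "realized a (int N + 1)" by simp
      then show ?case
        by (rule realized_conj[of _ _ "nat (a - 1)"])
          (use step True in \<open>(unfold rho_unfold, auto split: if_splits)\<close>)
    qed
  next
    case False
    then have "N = Suc l" using N l_bounds by simp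
    have "realized a (int N)" using a n by (intro realized_positive) auto
    then show ?thesis
      by (rule realized_conj[of _ _ N])
        (use a \<open>N = Suc l\<close> in \<open>(unfold rho_unfold, auto split: if_splits)\<close>)
  qed
  have "b \<le> int N" using ab n by simp
  then show ?thesis
    using ab(2)
  proof (induction b rule: int_le_induct)
    case base
    then show ?case using top[of a] ab n by (simp add: M_def)
  next
    case (step b)
    then have "realized a (M - b)" by simp
    then show ?case
      by (rule realized_conj[of _ _ "nat (b - 1)"])
        (use step ab N in \<open>(unfold rho_unfold, auto split: if_splits)\<close>)
  qed
qed

text \<open>A pair, its reversal and its mirror image have the same signed swap, which reduces every
  case to two entries in the lower half or to \<open>(a, M - b)\<close> with \<open>a < b\<close>
  there.\<close>

lemma realized_root_pair:
  assumes "(a, b) \<in> root_pairs"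
  shows "realized a b"
proof -
  have ab: "1 \<le> a" "a < b" "b \<le> top_point" "a + b \<noteq> M" using assms by (auto simp: root_pairs_def)
  show ?thesis
  proof (cases "b \<le> int coords")
    case True
    then show ?thesis using ab by (intro realized_positive)
  next
    case b: False
    then have N: "l < N" and bM: "1 \<le> M - b" "M - b \<le> int coords"
      using ab by (auto simp: top_point_def M_def split: if_splits)
    show ?thesis
    proof (cases "a \<le> int coords")
      case True
      consider "a < M - b" | "M - b < a" using ab by linarith
      then show ?thesis
      proof cases
        case 1
        then show ?thesis using realized_negative[OF N ab(1) 1] bM by simp
      next
        case 2
        then have "realized (M - b) (M - a)" using realized_negative[OF N bM(1) 2] True by simp
        from realized_bar[OF this] have "realized (M - (M - b)) (M - (M - a))" using ab by simp
        then show ?thesis using realized_sym by simp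
      qed
    next
      case False
      then have "realized (M - b) (M - a)"
        using ab bM by (intro realized_positive) (auto simp: M_def)
      from realized_bar[OF this] have "realized (M - (M - b)) (M - (M - a))" using ab by simp
      then show ?thesis using realized_sym by simp
    qed
  qed
qed

lemma finite_linked_pairs: "finite linked_pairs"
  by (rule finite_subset[of _ "root_pairs \<times> root_pairs"])
    (auto simp: linked_pairs_def finite_root_pairs)

sublocale inversion_action W N s m \<rho> root_pairs growth "signed_swap M" linked_pairs
proof unfold_locales
  fix p assume "p \<in> root_pairs"
  then show "\<exists>u. set u \<subseteq> {1..N} \<and> foldr \<rho> u = signed_swap M p"
    using realized_root_pair by (cases p) (auto simp: realized_def)
next
  fix p a b assume "p \<in> root_pairs" "(a, b) \<in> root_pairs" "(p, (a, b)) \<notin> linked_pairs"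
  then show "signed_swap M p a = a \<and> signed_swap M p b = b"
    by (cases p) (auto simp: linked_pairs_def signed_swap_def)
qed (use rho_inj rho_relator finite_root_pairs finite_linked_pairs rho_root_pairs rho_inversions
      in \<open>auto simp: root_pairs_def signed_swap_def\<close>)

end

section \<open>Counting proper elements\<close>

context branched_path
begin

definition points :: nat where "points = nat top_point"

lemma points_bounds: "points = (if l < N then 2 * N else N + 1)" "int points = top_point"
  by (auto simp: points_def top_point_def coords_def)

text \<open>Each \<open>b\<close> has \<open>b - 1\<close> smaller points, of which at most one is
  its mirror image \<open>M - b\<close>.\<close>

lemma card_root_pairs: "real points * (real points - 3) / 2 \<le> real (card root_pairs)"
proof -
  let ?S = "SIGMA b:{1..points}. {1..<int b} - {M - int b}"
  let ?f = "\<lambda>(b, a). (a, int b)"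
  have gauss: "(\<Sum>b=1..n. real b - 2) = real n * (real n - 3) / 2" for n
    by (induction n) (auto simp: algebra_simps)
  have "?f ` ?S \<subseteq> root_pairs"
    using points_bounds(2) by (auto simp: root_pairs_def)
  moreover have "inj_on ?f ?S" by (auto simp: inj_on_def)
  ultimately have le: "card ?S \<le> card root_pairs"
    using finite_root_pairs by (intro card_inj_on_le)
  have "(\<Sum>b=1..points. real b - 2) \<le> (\<Sum>b=1..points. real (card ({1..<int b} - {M - int b})))"
  proof (rule sum_mono)
    fix b assume "b \<in> {1..points}"
    have "card {1..<int b} - card {M - int b} \<le> card ({1..<int b} - {M - int b})"
      by (rule diff_card_le_card_Diff) simp
    then show "real b - 2 \<le> real (card ({1..<int b} - {M - int b}))" by simp
  qed
  also have "\<dots> = real (card ?S)" by (subst card_SigmaI) auto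
  also have "\<dots> \<le> real (card root_pairs)" using le by (rule of_nat_mono)
  finally show ?thesis unfolding gauss .
qed

text \<open>One entry of the second pair takes at most 4 values and the other is free, so each first
  pair admits at most \<open>8 * points\<close> second pairs.\<close>

lemma card_linked_pairs: "card linked_pairs \<le> 8 * points ^ 3"
proof -
  let ?T = "{1..top_point}"
  let ?S = "\<lambda>p. {fst p, snd p, M - fst p, M - snd p}"
  have T: "card ?T = points" by (simp add: points_def)
  have "linked_pairs \<subseteq> (SIGMA p:?T \<times> ?T. ?S p \<times> ?T \<union> ?T \<times> ?S p)"
    by (auto simp: linked_pairs_def root_pairs_def)
  then have "card linked_pairs \<le> card (SIGMA p:?T \<times> ?T. ?S p \<times> ?T \<union> ?T \<times> ?S p)"
    by (intro card_mono finite_SigmaI) auto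
  also have "\<dots> = (\<Sum>p\<in>?T \<times> ?T. card (?S p \<times> ?T \<union> ?T \<times> ?S p))"
    by (intro card_SigmaI) auto
  also have "\<dots> \<le> (\<Sum>p\<in>?T \<times> ?T. 8 * points)"
  proof (rule sum_mono)
    fix p
    have "card (?S p) \<le> 4" by (simp add: card_insert_if)
    then have "card (?S p) * points \<le> 4 * points" by (rule mult_le_mono1)
    moreover have "card (?S p \<times> ?T) = card (?S p) * points" "card (?T \<times> ?S p) = card (?S p) * points"
      by (simp_all only: card_cartesian_product T mult.commute)
    ultimately show "card (?S p \<times> ?T \<union> ?T \<times> ?S p) \<le> 8 * points"
      using card_Un_le[of "?S p \<times> ?T" "?T \<times> ?S p"] by linarith
  qed
  also have "\<dots> = 8 * points ^ 3"
    by (simp add: card_cartesian_product power3_eq_cube points_def)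
  finally show ?thesis .
qed

text \<open>Near the mean, \<open>d\<close> stays below \<open>11/20 N\<close>, so a proper element
  is too short for a typical number of inversions. The margin is quadratic, and
  \<open>100 \<le> N\<close> absorbs the linear terms.\<close>

lemma proper_is_atypical:
  assumes N: "100 \<le> N" and w: "w \<in> carrier W" "proper w"
  shows "real N / 10 \<le> \<bar>2 * real (card (left_descents w)) - real N\<bar> \<or>
    (real N)\<^sup>2 / 10 \<le> \<bar>real (card root_pairs) - 2 * real (card (inversions (act w)))\<bar>"
proof (rule ccontr)
  assume "\<not> ?thesis"
  then have "\<bar>2 * real (card (left_descents w)) - real N\<bar> < real N / 10"
    and "\<bar>real (card root_pairs) - 2 * real (card (inversions (act w)))\<bar> < (real N)\<^sup>2 / 10"
    by (simp_all only: de_Morgan_disj not_le)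
  then have d: "2 * real (card (left_descents w)) < 11 / 10 * real N"
    and x: "real (card root_pairs) - (real N)\<^sup>2 / 10 < 2 * real (card (inversions (act w)))"
    by linarith+
  define n where "n = real N"
  define d' where "d' = real (card (left_descents w))"
  have n: "100 \<le> n" using N by (simp add: n_def)
  have "d' * (d' + 1) \<le> (11 / 20 * n) * (11 / 20 * n + 1)"
    using d by (intro mult_mono) (auto simp: n_def d'_def)
  also have "\<dots> = 121 / 400 * n\<^sup>2 + 11 / 20 * n" by (simp add: algebra_simps power2_eq_square)
  finally have dd: "d' * (d' + 1) \<le> 121 / 400 * n\<^sup>2 + 11 / 20 * n" .
  have "real (2 * cox_length w) \<le> real (2 * N + growth *
      (card (left_descents w) * (card (left_descents w) + 1)))"
    using proper_length_bound[OF w(2)] by (rule of_nat_mono)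
  then have len: "2 * real (cox_length w) \<le> 2 * n + real growth * (d' * (d' + 1))"
    by (simp add: n_def d'_def distrib_left)
  have inv: "real (card (inversions (act w))) \<le> real growth * real (cox_length w)"
    using inversions_le_length[OF w(1)] by (metis of_nat_mono of_nat_mult)
  have quad: "100 * n \<le> n\<^sup>2" using n by (simp add: power2_eq_square)
  show False
  proof (cases "l < N")
    case True
    then have "2 * n * (2 * n - 3) / 2 \<le> real (card root_pairs)"
      using card_root_pairs points_bounds by (simp add: n_def)
    moreover have "2 * n * (2 * n - 3) / 2 = 2 * n\<^sup>2 - 3 * n"
      by (simp add: power2_eq_square field_simps)
    ultimately show False using x inv len dd quad n True
      by (simp add: growth_def flip: n_def)
  next
    case False
    then have "(n + 1) * (n - 2) / 2 \<le> real (card root_pairs)"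
      using card_root_pairs points_bounds by (simp add: n_def algebra_simps)
    moreover have "(n + 1) * (n - 2) / 2 = n\<^sup>2 / 2 - n / 2 - 1"
      by (simp add: power2_eq_square field_simps)
    ultimately show False using x inv len dd quad n False
      by (simp add: growth_def flip: n_def)
  qed
qed

text \<open>The constant is \<open>500 + 6400\<close>, from \<open>100 * 5\<close> for descents and
  \<open>100 * 64\<close> for inversions; \<open>100\<close> comes from deviations of one tenth,
  \<open>64\<close> from \<open>8 * (2 * N) ^ 3\<close>.\<close>

lemma card_proper_bound:
  assumes N: "100 \<le> N"
  shows "real (card {w \<in> carrier W. proper w}) * real N \<le> 6900 * real (card (carrier W))"
proof -
  define n where "n = real N"
  have n: "100 \<le> n" using N by (simp add: n_def)
  define A where "A = {w \<in> carrier W. n / 10 \<le> \<bar>2 * real (card (left_descents w)) - real N\<bar>}"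
  define B where "B = {w \<in> carrier W.
    n\<^sup>2 / 10 \<le> \<bar>real (card root_pairs) - 2 * real (card (inversions (act w)))\<bar>}"
  define g where "g = real (card (carrier W))"
  have "{w \<in> carrier W. proper w} \<subseteq> A \<union> B"
    using proper_is_atypical[OF N] by (auto simp: A_def B_def n_def)
  then have "card {w \<in> carrier W. proper w} \<le> card (A \<union> B)"
    by (rule card_mono[rotated]) (auto simp: A_def B_def finite_group)
  also have "\<dots> \<le> card A + card B" by (rule card_Un_le)
  finally have AB: "real (card {w \<in> carrier W. proper w}) \<le> real (card A) + real (card B)" by simp
  have "real (card A) * (n / 10)\<^sup>2 \<le> g * real (card {(j, k). j \<in> gens \<and> k \<in> gens \<and> (j = k \<or> m j k \<noteq> 2)})"
    using descents_concentrated[OF finite_group, of "n / 10"] n by (simp add: A_def g_def)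
  also have "\<dots> \<le> g * (5 * n)"
  proof -
    have "real (card {(j, k). j \<in> gens \<and> k \<in> gens \<and> (j = k \<or> m j k \<noteq> 2)}) \<le> real (5 * N)"
      using noncommuting_pairs by (rule of_nat_mono)
    then show ?thesis by (intro mult_left_mono) (auto simp: n_def g_def)
  qed
  finally have "(real (card A) * n) * n \<le> (500 * g) * n"
    by (simp add: power2_eq_square algebra_simps)
  then have A: "real (card A) * n \<le> 500 * g" using n by simp
  have "real (card B) * (n\<^sup>2 / 10)\<^sup>2 \<le> g * real (card linked_pairs)"
    using inversions_concentrated[OF finite_group, of "n\<^sup>2 / 10"] by (simp add: B_def g_def)
  also have "\<dots> \<le> g * (64 * n ^ 3)"
  proof -
    have "points \<le> 2 * N" using points_bounds N by auto
    then have "8 * points ^ 3 \<le> 8 * (2 * N) ^ 3" by (intro mult_left_mono power_mono) auto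
    then have "card linked_pairs \<le> 64 * N ^ 3" using card_linked_pairs by (simp add: power_mult_distrib)
    then have "real (card linked_pairs) \<le> real (64 * N ^ 3)" by (rule of_nat_mono)
    then show ?thesis by (intro mult_left_mono) (auto simp: n_def g_def)
  qed
  finally have "(real (card B) * n) * n ^ 3 \<le> (6400 * g) * n ^ 3"
    by (simp add: power2_eq_square power3_eq_cube algebra_simps)
  then have B: "real (card B) * n \<le> 6400 * g" using n by simp
  have "real (card {w \<in> carrier W. proper w}) * n \<le> (real (card A) + real (card B)) * n"
    using AB n by (intro mult_right_mono) auto
  then show ?thesis using A B by (simp add: algebra_simps n_def g_def)
qed

end

section \<open>Dihedral groups\<close>

locale dihedral_system = coxeter_system W 2 s "family_matrix Type_I2 n"
  for W :: "('a, 'b) monoid_scheme" (structure) and s n +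
  assumes n_pos: "3 \<le> n"
begin

abbreviation rot :: 'a where "rot \<equiv> s 1 \<otimes> s 2"

lemma gens_1_2 [simp]: "s 1 \<in> carrier W" "s 2 \<in> carrier W" "s (Suc 0) \<in> carrier W"
  by auto

lemma rot_order: "rot [^] n = \<one>"
proof -
  have "wp (concat (replicate a [1, 2])) = rot [^] a" for a
  proof (induction a)
    case (Suc a)
    then show ?case using nat_pow_Suc2[of rot a] by (simp add: m_assoc)
  qed simp
  then show ?thesis using wp_relator[of 1 2] by (simp add: family_matrix_def)
qed

lemma rot_mod: "rot [^] k = rot [^] (k mod n)"
proof -
  have "rot [^] k = rot [^] (n * (k div n)) \<otimes> rot [^] (k mod n)"
    by (simp add: nat_pow_mult)
  also have "rot [^] (n * (k div n)) = \<one>"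
    using rot_order by (simp flip: nat_pow_pow)
  finally show ?thesis by simp
qed

lemma carrier_rotations:
  "carrier W \<subseteq> (\<lambda>k. rot [^] k) ` {..<n} \<union> (\<lambda>k. rot [^] k \<otimes> s 1) ` {..<n}"
proof
  fix w assume "w \<in> carrier W"
  then obtain u where u: "set u \<subseteq> gens" "wp u = w" using word_of by blast
  have "\<exists>k::nat. wp u = rot [^] k \<or> wp u = rot [^] k \<otimes> s 1"
    using u(1)
  proof (induction u rule: rev_induct)
    case Nil
    then show ?case by (intro exI[of _ 0]) simp
  next
    case (snoc i u)
    then obtain k :: nat where k: "wp u = rot [^] k \<or> wp u = rot [^] k \<otimes> s 1" by auto
    have i: "i = 1 \<or> i = 2" and u: "set u \<subseteq> gens" using snoc.prems by auto
    have wp: "wp (u @ [i]) = wp u \<otimes> s i" using snoc.prems by (simp add: wp_append)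
    \<comment> \<open>Here \<open>s 2\<close> is the inverse rotation times \<open>s 1\<close>, with
      the inverse written as the natural power \<open>n - 1\<close>.\<close>
    have r2: "rot [^] k \<otimes> s 2 = rot [^] (k + (n - 1)) \<otimes> s 1"
    proof -
      have "rot [^] (n - 1) \<otimes> rot = \<one>"
        using rot_order n_pos by (metis Suc_diff_1 nat_pow_Suc less_le_trans zero_less_numeral)
      then have "rot [^] (n - 1) = inv rot" by (simp add: inv_equality)
      also have "\<dots> = s 2 \<otimes> s 1" by (simp add: inv_mult_group)
      finally show ?thesis by (simp add: m_assoc flip: nat_pow_mult)
    qed
    have r1: "rot [^] k \<otimes> s 1 \<otimes> s 2 = rot [^] Suc k" by (simp add: m_assoc)
    show ?case using k i r1 r2 unfolding wp by (auto simp del: nat_pow_Suc) (metis nat_pow_Suc)+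
  qed
  then obtain k :: nat where "w = rot [^] (k mod n) \<or> w = rot [^] (k mod n) \<otimes> s 1"
    using u(2) rot_mod by metis
  moreover have "k mod n < n" using n_pos by simp
  ultimately show "w \<in> (\<lambda>k. rot [^] k) ` {..<n} \<union> (\<lambda>k. rot [^] k \<otimes> s 1) ` {..<n}" by blast
qed

lemma finite_dihedral: "finite (carrier W)"
  using carrier_rotations by (rule finite_subset) auto

text \<open>The dihedral action on residues modulo \<open>n\<close>, normalized to
  \<open>0, ..., n - 1\<close>; applying generator 1 and then generator 2 adds 1.\<close>

definition reflect :: "nat \<Rightarrow> int \<Rightarrow> int" where
  "reflect i x = (int i - 1 - x) mod int n"

lemma reflect_range: "0 \<le> reflect i x" "reflect i x < int n"
  using n_pos by (auto simp: reflect_def)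

lemma reflect_reflect: "reflect i (reflect j x) = (x + (int i - int j)) mod int n"
  unfolding reflect_def mod_diff_right_eq by (simp add: algebra_simps)

lemma foldr_reflect_range:
  "0 \<le> x \<Longrightarrow> x < int n \<Longrightarrow> 0 \<le> foldr reflect u x \<and> foldr reflect u x < int n"
  by (cases u) (auto simp: reflect_range)

lemma foldr_reflect_power:
  assumes "0 \<le> x" "x < int n"
  shows "foldr reflect (concat (replicate k [i, j])) x = (x + int k * (int i - int j)) mod int n"
proof (induction k)
  case (Suc k)
  then have "foldr reflect (concat (replicate (Suc k) [i, j])) x =
      (x + int k * (int i - int j) + (int i - int j)) mod int n"
    by (simp add: reflect_reflect mod_add_left_eq)
  then show ?case by (simp add: algebra_simps)
qed (use assms in simp)

text \<open>The element \<open>(s_2 s_1)^k\<close> sends \<open>0\<close> to \<open>k\<close> for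
  \<open>k < n\<close>, so these \<open>n\<close> powers are distinct.\<close>

lemma card_dihedral_ge: "n \<le> card (carrier W)"
proof -
  have inv: "foldr reflect u 0 = foldr reflect v 0"
    if "wp u = wp v" "set u \<subseteq> gens" "set v \<subseteq> gens" for u v
    using _ that
  proof (rule word_invariant)
    fix u v i j assume ij: "i \<in> gens" "j \<in> gens"
    define x where "x = foldr reflect v 0"
    have x: "0 \<le> x" "x < int n" using foldr_reflect_range[of 0 v] n_pos by (auto simp: x_def)
    have "foldr reflect (concat (replicate (family_matrix Type_I2 n i j) [i, j])) x = x"
    proof (cases "i = j")
      case True
      then show ?thesis using foldr_reflect_power[OF x] x by (simp add: family_matrix_def reflect_reflect)
    next
      case False
      then show ?thesis using foldr_reflect_power[OF x] x by (simp add: family_matrix_def)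
    qed
    then show "foldr reflect (u @ concat (replicate (family_matrix Type_I2 n i j) [i, j]) @ v) 0 =
        foldr reflect (u @ v) 0"
      by (simp add: x_def)
  qed
  have inj: "inj_on (\<lambda>k. wp (concat (replicate k [2, 1]))) {..<n}"
  proof (rule inj_onI)
    fix k k' assume k: "k \<in> {..<n}" "k' \<in> {..<n}"
      and eq: "wp (concat (replicate k [2, 1])) = wp (concat (replicate k' [2, 1]))"
    have "foldr reflect (concat (replicate k [2, 1])) 0 = foldr reflect (concat (replicate k' [2, 1])) 0"
      by (rule inv[OF eq]; rule relator_in_gens) auto
    then show "k = k'" using foldr_reflect_power[of 0] k n_pos by simp
  qed
  have "(\<lambda>k. wp (concat (replicate k [2, 1]))) ` {..<n} \<subseteq> carrier W"
    by (rule image_subsetI, rule wp_closed, rule relator_in_gens) auto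
  then have "card {..<n} \<le> card (carrier W)"
    using card_inj_on_le[OF inj _ finite_dihedral] by blast
  then show ?thesis by simp
qed

lemma card_full_descents:
  "card {w \<in> carrier W. card (left_descents w) = 2} \<le> 1"
proof -
  let ?d = "\<lambda>w. card (left_descents w)"
  let ?ind = "\<lambda>k w. if ?d w = k then 1 else 0 :: real"
  have "(\<Sum>w\<in>carrier W. \<Sum>j\<in>gens. descent_sign j w) = 0"
    by (subst sum.swap) (simp add: sum_descent_sign_group)
  then have zero: "(\<Sum>w\<in>carrier W. 2 * real (?d w) - 2) = 0"
    unfolding sum_descent_sign by simp
  have "2 * real (?d w) - 2 = 2 * (?ind 2 w - ?ind 0 w)" for w
  proof -
    have "?d w = 0 \<or> ?d w = 1 \<or> ?d w = 2" using card_descents_le[of w] by linarith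
    then show ?thesis by auto
  qed
  then have "(\<Sum>w\<in>carrier W. 2 * (?ind 2 w - ?ind 0 w)) = 0" using zero by simp
  then have "(\<Sum>w\<in>carrier W. ?ind 2 w) = (\<Sum>w\<in>carrier W. ?ind 0 w)"
    by (simp add: sum_subtractf flip: sum_distrib_left)
  then have "card {w \<in> carrier W. ?d w = 2} = card {w \<in> carrier W. ?d w = 0}"
    using finite_dihedral by (simp add: sum.If_cases Int_def)
  also have "\<dots> \<le> card {\<one>}"
  proof (rule card_mono)
    have "finite (left_descents w)" for w
      by (rule finite_subset[of _ gens]) (auto simp: left_descents_def)
    then show "{w \<in> carrier W. ?d w = 0} \<subseteq> {\<one>}" using descent_exists by auto
  qed simp
  finally show ?thesis by simp
qed

lemma maxw0_small: "x \<le> 1 \<Longrightarrow> maxw0 x \<le> 1"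
proof (rule maxw0_le)
  fix I w assume x: "x \<le> 1" and I: "I \<subseteq> gens" "card I = x" "w \<in> parabolic I"
  have fin: "finite I" using I finite_subset by blast
  obtain i where i: "i \<in> gens" "I \<subseteq> {i}"
  proof (cases "x = 0")
    case True
    then show ?thesis using I fin that[of 1] by simp
  next
    case False
    then obtain i where "I = {i}" using I x by (metis card_1_singletonE le_antisym less_one not_le)
    then show ?thesis using I that[of i] by auto
  qed
  obtain u where u: "set u \<subseteq> I" "wp u = w" using word_in_parabolic[OF I(1,3)] .
  have "wp v \<in> {\<one>, s i}" if "set v \<subseteq> {i}" for v
    using that i(1) by (induction v) auto
  then have "w \<in> {\<one>, s i}" using u i by blast
  then show "cox_length w \<le> 1"
    using cox_length_le[of "[]"] cox_length_le[of "[i]"] i(1) by auto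
qed simp

text \<open>Rank 2 and \<open>maxw0 \<le> 1\<close> give length at most 3 unless both generators are
  descents. There are \<open>1 + 2 + 4 + 8 = 15\<close> words of such length, and at most one
  element has two descents.\<close>

lemma card_proper_dihedral: "card {w \<in> carrier W. proper w} \<le> 16"
proof -
  let ?S = "{w \<in> carrier W. cox_length w \<le> 3}"
  let ?T = "{w \<in> carrier W. card (left_descents w) = 2}"
  have "{w \<in> carrier W. proper w} \<subseteq> ?S \<union> ?T"
  proof
    fix w assume w: "w \<in> {w \<in> carrier W. proper w}"
    show "w \<in> ?S \<union> ?T"
    proof (cases "card (left_descents w) \<le> 1")
      case True
      then show ?thesis using maxw0_small[OF True] w by (auto simp: proper_def)
    next
      case False
      then show ?thesis using card_descents_le[of w] w by auto
    qed
  qed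
  then have "card {w \<in> carrier W. proper w} \<le> card (?S \<union> ?T)"
    by (rule card_mono[rotated]) (use finite_dihedral in auto)
  also have "\<dots> \<le> card ?S + card ?T" by (rule card_Un_le)
  also have "card ?S \<le> card (wp ` {u. set u \<subseteq> gens \<and> length u \<le> 3})"
  proof (rule card_mono)
    show "finite (wp ` {u. set u \<subseteq> gens \<and> length u \<le> 3})"
      using finite_lists_length_le[of gens] by auto
    show "?S \<subseteq> wp ` {u. set u \<subseteq> gens \<and> length u \<le> 3}"
    proof
      fix w assume w: "w \<in> ?S"
      then obtain u where "set u \<subseteq> gens" "wp u = w" "length u = cox_length w"
        using reduced_word[of w] by auto
      with w show "w \<in> wp ` {u. set u \<subseteq> gens \<and> length u \<le> 3}" by auto
    qed
  qed
  also have "\<dots> \<le> card {u. set u \<subseteq> gens \<and> length u \<le> 3}"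
    using finite_lists_length_le[of gens] by (intro card_image_le) auto
  also have "\<dots> = 15" by (simp add: card_lists_length_le eval_nat_numeral)
  finally show ?thesis using card_full_descents by simp
qed

end

section \<open>Asymptotics\<close>

lemma proper_density_bound:
  assumes n: "102 \<le> n"
    and sys: "coxeter_system W (family_rank F n) s (family_matrix F n)"
  shows "finite (carrier W) \<and>
    real (card {w \<in> carrier W. coxeter_system.proper W (family_rank F n) s w}) * real n
      \<le> 6900 * real (card (carrier W))"
proof -
  have path: ?thesis if "branched_path W n s (family_matrix F n) l" "family_rank F n = n" for l
  proof -
    interpret branched_path W n s "family_matrix F n" l by (rule that)
    show ?thesis using finite_group card_proper_bound n that(2) by simp
  qed
  show ?thesis
  proof (cases F)
    case Type_A
    have "branched_path W n s (family_matrix F n) n"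
      using sys n unfolding Type_A
      by (auto simp: branched_path_def branched_path_axioms_def family_matrix_def)
    then show ?thesis using path Type_A by simp
  next
    case Type_B
    have "branched_path W n s (family_matrix F n) (n - 1)"
      using sys n unfolding Type_B
      by (auto simp: branched_path_def branched_path_axioms_def family_matrix_def)
    then show ?thesis using path Type_B by simp
  next
    case Type_D
    have "branched_path W n s (family_matrix F n) (n - 2)"
      using sys n unfolding Type_D
      by (auto simp: branched_path_def branched_path_axioms_def family_matrix_def)
    then show ?thesis using path Type_D by simp
  next
    case Type_I2
    interpret dihedral_system W s n
      using sys n unfolding Type_I2
      by (auto simp: dihedral_system_def dihedral_system_axioms_def)
    have "real (card {w \<in> carrier W. proper w}) * real n \<le> real 16 * real (card (carrier W))"
      using card_proper_dihedral card_dihedral_ge by (intro mult_mono) (auto simp: Type_I2)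
    then show ?thesis using finite_dihedral by (simp add: Type_I2)
  qed
qed

theorem theorem1p6:
  fixes F :: coxeter_family
    and W :: "nat \<Rightarrow> 'a monoid"
    and s :: "nat \<Rightarrow> nat \<Rightarrow> 'a"
  assumes "\<And>n. n \<ge> min_index F \<Longrightarrow>
    coxeter_system (W n) (family_rank F n) (s n) (family_matrix F n)"
  shows "(\<lambda>n. measure_pmf.prob (pmf_of_set (carrier (W n)))
            {w \<in> carrier (W n). coxeter_system.proper (W n) (family_rank F n) (s n) w})
          \<longlonglongrightarrow> 0"
proof (rule tendsto_sandwich[where f = "\<lambda>_. 0" and h = "\<lambda>n. 6900 / real n"])
  let ?P = "\<lambda>n. {w \<in> carrier (W n). coxeter_system.proper (W n) (family_rank F n) (s n) w}"
  show "\<forall>\<^sub>F n in sequentially. measure_pmf.prob (pmf_of_set (carrier (W n))) (?P n) \<le> 6900 / real n"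
    using eventually_ge_at_top[of 102]
  proof eventually_elim
    case (elim n)
    have "min_index F \<le> n" using elim by (cases F) auto
    then have sys: "coxeter_system (W n) (family_rank F n) (s n) (family_matrix F n)"
      by (rule assms)
    then interpret group "W n" by (rule coxeter_system.axioms)
    have fin: "finite (carrier (W n))"
      and bound: "real (card (?P n)) * real n \<le> 6900 * real (card (carrier (W n)))"
      using proper_density_bound[OF elim sys] by auto
    \<comment> \<open>\<open>pmf_of_set\<close> is the uniform distribution only on a finite
      nonempty set; finiteness has just been derived from the presentation.\<close>
    have ne: "carrier (W n) \<noteq> {}" by auto
    then have pos: "0 < real (card (carrier (W n)))" using fin by (simp add: card_gt_0_iff)
    have "measure_pmf.prob (pmf_of_set (carrier (W n))) (?P n)
        = real (card (?P n)) / real (card (carrier (W n)))"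
      using fin ne by (simp add: measure_pmf_of_set Int_def conj_ac)
    also have "\<dots> \<le> 6900 / real n"
      using bound pos elim by (simp add: field_simps)
    finally show ?case .
  qed
  show "(\<lambda>n. 6900 / real n) \<longlonglongrightarrow> 0" by (rule lim_const_over_n)
qed auto

end
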